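(* Let $B=(V,E)$ be a Bratteli diagram with $M_n=|V_n|\ge 1$ vertices in the $n$th level, all of whose incidence matrices have all entries equal to $1$, i.e. $F_n=\mathbf 1_{M_{n+1}\times M_n}$ for every $n\ge 0$ (there is exactly one edge between any vertex of $V_n$ and any vertex of $V_{n+1}$). Then the following dichotomy holds. (1) If $\sum_n 1/M_n=\infty$, then for $\mathbb P$-almost every order $\omega\in\mathcal O_B$ there is a unique infinite maximal path, i.e. $|X_{\max}(\omega)|=1$. (2) If $\sum_n 1/M_n<\infty$, then for $\mathbb P$-almost every order $\omega\in\mathcal O_B$ there are uncountably many infinite maximal paths, i.e. $X_{\max}(\omega)$ is uncountable.
   Context: A Bratteli diagram is an infinite graph $B=(V,E)$ (multiple edges allowed) with $V=\bigcup_{i\ge0}V_i$ and $E=\bigcup_{i\ge1}E_i$ partitioned into disjoint finite sets, $V_0=\{v_0\}$ a single point, with range and source maps $r,s:E\to V$ such that $r(E_i)=V_i$ and $s(E_i)=V_{i-1}$. The $n$-th incidence matrix $F_n=(f^{(n)}_{v,w})$, $n\ge0$, is the $|V_{n+1}|\times|V_n|$ matrix with $f^{(n)}_{v,w}=|\{e\in E_{n+1}: r(e)=v, s(e)=w\}|$ for $v\in V_{n+1}$, $w\in V_n$. $\mathbf 1_{a\times b}$ is the $a\times b$ matrix with all entries $1$. $X_B$ is the set of infinite paths $(e_i)_{i\ge1}$, $e_i\in E_i$, $r(e_i)=s(e_{i+1})$, starting at $v_0$. An order $\omega$ on $B$ is a choice of a linear order $\omega_v$ on $r^{-1}(v)$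 for every $v\in V\setminus V_0$; $\mathcal O_B=\prod_{v\in V\setminus V_0}P_v$ is the set of all orders, where $P_v$ is the set of linear orders on $r^{-1}(v)$. A path is maximal for $\omega$ if each of its edges $e_i$ is the maximal element of $r^{-1}(r(e_i))$; $X_{\max}(\omega)\subset X_B$ is the set of infinite maximal paths. $\mathbb P$ is the completion of the product measure $\prod_{v\in V\setminus V_0}\mathbb P_v$ on $\mathcal O_B$ (with the product $\sigma$-algebra), where $\mathbb P_v$ is the uniform probability measure on the finite set $P_v$. *)

theory Defs
  imports "HOL-Probability.Probability"
begin

text \<open>Edge levels are indexed from 1: an edge in \<open>edges B i\<close> joins level \<open>i - 1\<close> to level \<open>i\<close>,
  and \<open>edges B 0\<close> is not used.\<close>

record ('v, 'e) diagram =
  verts :: "nat \<Rightarrow> 'v set"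
  edges :: "nat \<Rightarrow> 'e set"
  root :: 'v
  rng :: "'e \<Rightarrow> 'v"
  src :: "'e \<Rightarrow> 'v"

locale bratteli_diagram =
  fixes B :: "('v, 'e) diagram"
  assumes finite_verts: "\<And>i. finite (verts B i)"
    and disjoint_verts: "disjoint_family (verts B)"
    and verts_0: "verts B 0 = {root B}"
    and finite_edges: "\<And>i. 1 \<le> i \<Longrightarrow> finite (edges B i)"
    and disjoint_edges: "disjoint_family_on (edges B) {1..}"
    and rng_edges: "\<And>i. 1 \<le> i \<Longrightarrow> rng B ` edges B i = verts B i"
    and src_edges: "\<And>i. 1 \<le> i \<Longrightarrow> src B ` edges B i = verts B (i - 1)"

definition all_edges :: "('v, 'e) diagram \<Rightarrow> 'e set" where
  "all_edges B = (\<Union>i\<in>{1..}. edges B i)"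

definition nonroot_verts :: "('v, 'e) diagram \<Rightarrow> 'v set" where
  "nonroot_verts B = (\<Union>i. verts B i) - verts B 0"

definition in_edges :: "('v, 'e) diagram \<Rightarrow> 'v \<Rightarrow> 'e set" where
  "in_edges B v = {e \<in> all_edges B. rng B e = v}"

text \<open>The entry of the \<open>n\<close>-th incidence matrix in row \<open>v \<in> verts B (n + 1)\<close> and column
  \<open>w \<in> verts B n\<close>; values at other arguments are irrelevant.\<close>

definition incidence :: "('v, 'e) diagram \<Rightarrow> nat \<Rightarrow> 'v \<Rightarrow> 'v \<Rightarrow> nat" where
  "incidence B n v w = card {e \<in> edges B (n + 1). rng B e = v \<and> src B e = w}"

text \<open>A path \<open>(e\<^sub>1, e\<^sub>2, \<dots>)\<close> is encoded as the sequence \<open>p\<close> with \<open>p i = e\<^bsub>i+1\<^esub>\<close>, so that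
  paths correspond one-to-one to functions on all of \<open>nat\<close>.\<close>

definition inf_paths :: "('v, 'e) diagram \<Rightarrow> (nat \<Rightarrow> 'e) set" where
  "inf_paths B = {p. src B (p 0) = root B \<and>
     (\<forall>i. p i \<in> edges B (i + 1) \<and> rng B (p i) = src B (p (i + 1)))}"

text \<open>A linear order is a reflexive relation, where \<open>(e, f)\<close> belonging to it means
  that \<open>e\<close> is at most \<open>f\<close>.\<close>

definition vertex_orders :: "('v, 'e) diagram \<Rightarrow> 'v \<Rightarrow> 'e rel set" where
  "vertex_orders B v = {R. linear_order_on (in_edges B v) R}"

text \<open>The underlying space is the set of all orders on the diagram,
  \<open>Pi\<^sub>E (nonroot_verts B) (vertex_orders B)\<close>.\<close>

definition order_measure :: "('v, 'e) diagram \<Rightarrow> ('v \<Rightarrow> 'e rel) measure" where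
  "order_measure B =
     completion (Pi\<^sub>M (nonroot_verts B) (\<lambda>v. uniform_count_measure (vertex_orders B v)))"

definition max_edge :: "('v, 'e) diagram \<Rightarrow> ('v \<Rightarrow> 'e rel) \<Rightarrow> 'e \<Rightarrow> bool" where
  "max_edge B \<omega> e \<longleftrightarrow> (\<forall>f \<in> in_edges B (rng B e). (f, e) \<in> \<omega> (rng B e))"

definition max_paths :: "('v, 'e) diagram \<Rightarrow> ('v \<Rightarrow> 'e rel) \<Rightarrow> (nat \<Rightarrow> 'e) set" where
  "max_paths B \<omega> = {p \<in> inf_paths B. \<forall>i. max_edge B \<omega> (p i)}"

end

theory Submission
  imports Defs
begin

text \<open>A linear order on the edges into a vertex \<open>v\<close> matters for maximal paths only through its greatest
  edge, and under the uniform measure the source of that edge, the parent of \<open>v\<close>, is uniformly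
  distributed on the previous level, independently for different \<open>v\<close>. Maximal paths correspond to
  infinite ancestral lines, that is, to sequences with one vertex \<open>x n\<close> on each level \<open>n\<close> in which
  \<open>x n\<close> is the parent of \<open>x (n + 1)\<close>. Read from high levels downwards, the ancestors of a level form a
  coalescing system: two different vertices on level \<open>k + 1\<close> share their parent with probability
  \<open>1 / M\<^sub>k\<close>, so \<open>\<Sum>1 / M\<^sub>k\<close> is the natural time scale.

  Divergent sum. If \<open>a \<ge> 2\<close> vertices choose parents among \<open>M\<close>, the expected reciprocal of the number
  of chosen parents is at least \<open>1 / a + 1 / (4 M)\<close> (\<open>expected_inverse_number_of_parents\<close>). Summed
  over the levels between \<open>n\<close> and \<open>m\<close>, and because a reciprocal never exceeds 1, the probability that
  level \<open>m\<close> has at least two ancestors on level \<open>n\<close> is at most \<open>4 / (\<Sum>n\<le>k<m. 1 / M\<^sub>k)\<close>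
  (\<open>prob_not_coalesced\<close>), a bound that does not depend on how many vertices level \<open>m\<close> has. It tends
  to 0 in \<open>m\<close>, so almost surely every level contains only one vertex with descendants arbitrarily far
  up, and Koenig's lemma provides a line through these vertices.

  Convergent sum. The expected proportion of pairs on level \<open>m\<close> with a common ancestor on level \<open>n\<close> is
  at most \<open>\<Sum>n\<le>k\<le>m. 1 / M\<^sub>k\<close> (\<open>expected_kin_fraction\<close>), which is small uniformly in \<open>m\<close> once \<open>n\<close>
  is large. By Fatou's lemma, almost surely there are infinitely many levels \<open>m\<close> on which all vertices
  of a high level \<open>n\<close> have only a small proportion of descendants, with one bound for all these \<open>m\<close>.
  Given countably many lines, one can then cut each of them at a level so high that the descendants of
  all the cut vertices together fill at most half of such a level \<open>m\<close>. The remaining vertices form a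
  tree with all levels nonempty, and Koenig's lemma yields a line different from the given ones
  (\<open>uncountable_ancestral_lines\<close>).\<close>

section \<open>Infinite lines in a tree with finite levels\<close>

definition ancestral_lines :: "(nat \<Rightarrow> 'v set) \<Rightarrow> ('v \<Rightarrow> 'v) \<Rightarrow> (nat \<Rightarrow> 'v) set" where
  "ancestral_lines V f = {x. \<forall>n. x n \<in> V n \<and> f (x (Suc n)) = x n}"

lemma funpow_line:
  assumes "x \<in> ancestral_lines V f"
  shows "(f ^^ d) (x (n + d)) = x n"
  using assms by (induction d) (auto simp: ancestral_lines_def funpow_swap1)

lemma funpow_level:
  assumes "\<And>k. f ` V (Suc k) \<subseteq> V k" and "x \<in> V (n + d)"
  shows "(f ^^ d) x \<in> V n"
  using assms(2)
proof (induction d arbitrary: x)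
  case (Suc d)
  have "f x \<in> V (n + d)" using assms(1)[of "n + d"] Suc.prems by auto
  from Suc.IH[OF this] show ?case by (simp add: funpow_swap1)
qed simp

text \<open>If no element of the finite set worked for all \<open>d\<close>, each would fail from some point on, and beyond
  the largest of these points every element would fail.\<close>
lemma finite_pigeonhole_antimono:
  fixes Q :: "nat \<Rightarrow> 'a \<Rightarrow> bool"
  assumes "finite W" and ex: "\<And>d. \<exists>w\<in>W. Q d w"
    and anti: "\<And>d e w. Q e w \<Longrightarrow> d \<le> e \<Longrightarrow> Q d w"
  shows "\<exists>w\<in>W. \<forall>d. Q d w"
proof (rule ccontr)
  assume "\<not> ?thesis"
  then have "\<forall>w\<in>W. \<exists>d. \<not> Q d w" by blast
  then obtain c where c: "\<And>w. w \<in> W \<Longrightarrow> \<not> Q (c w) w" by metis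
  obtain w where w: "w \<in> W" "Q (Max (c ` W)) w" using ex by blast
  have "c w \<le> Max (c ` W)" using \<open>finite W\<close> w(1) by simp
  with anti w c show False by blast
qed

text \<open>Koenig's lemma: keep to the vertices with descendants on every higher level. By the pigeonhole
  principle there is one on the bottom level, and each of them has a child of the same kind.\<close>
lemma ancestral_lines_nonempty:
  assumes fin: "\<And>k. finite (V k)" and ne: "\<And>k. V k \<noteq> {}"
    and maps: "\<And>k. f ` V (Suc k) \<subseteq> V k"
  shows "ancestral_lines V f \<noteq> {}"
proof -
  define desc where "desc n d w \<longleftrightarrow> (\<exists>z\<in>V (n + d). (f ^^ d) z = w)" for n d w
  have anti: "desc n d w" if e: "desc n e w" and "d \<le> e" for n d e w
  proof -
    obtain z where z: "z \<in> V (n + e)" "(f ^^ e) z = w" using e by (auto simp: desc_def)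
    have "(f ^^ (e - d)) z \<in> V (n + d)"
      using funpow_level[of f V z "n + d" "e - d"] maps z(1) \<open>d \<le> e\<close> by simp
    moreover have "(f ^^ d) ((f ^^ (e - d)) z) = w"
      using z(2) \<open>d \<le> e\<close> by (metis comp_apply funpow_add le_add_diff_inverse)
    ultimately show ?thesis by (auto simp: desc_def)
  qed
  have base: "\<exists>w\<in>V 0. \<forall>d. desc 0 d w"
  proof (rule finite_pigeonhole_antimono)
    fix d
    obtain z where "z \<in> V d" using ne by blast
    then show "\<exists>w\<in>V 0. desc 0 d w"
      using funpow_level[of f V z 0 d] maps by (auto simp: desc_def)
  qed (use fin in \<open>blast intro: anti\<close>)+
  have step: "\<exists>w\<in>V (Suc n). \<forall>d. desc (Suc n) d w \<and> f w = u" if u: "\<forall>d. desc n d u" for n u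
  proof (rule finite_pigeonhole_antimono)
    fix d
    obtain z where z: "z \<in> V (n + Suc d)" "(f ^^ Suc d) z = u"
      using u unfolding desc_def by blast
    have "(f ^^ d) z \<in> V (Suc n)" using funpow_level[of f V z "Suc n" d] maps z(1) by simp
    then show "\<exists>w\<in>V (Suc n). desc (Suc n) d w \<and> f w = u" using z by (auto simp: desc_def)
  qed (use fin in \<open>blast intro: anti\<close>)+
  have "\<exists>x. \<forall>n. (x n \<in> V n \<and> (\<forall>d. desc n d (x n))) \<and> f (x (Suc n)) = x n"
  proof (rule dependent_nat_choice)
    show "\<exists>w. w \<in> V 0 \<and> (\<forall>d. desc 0 d w)" using base by blast
  next
    fix u n
    assume "u \<in> V n \<and> (\<forall>d. desc n d u)"
    with step[of n u] show "\<exists>w. (w \<in> V (Suc n) \<and> (\<forall>d. desc (Suc n) d w)) \<and> f w = u" by blast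
  qed
  then show ?thesis by (auto simp: ancestral_lines_def)
qed

text \<open>All lines pass through the ancestors on level \<open>n\<close> of every higher level, so they agree on level
  \<open>n\<close> as soon as some higher level has a single ancestor there.\<close>
lemma card_ancestral_lines_eq_1:
  assumes fin: "\<And>k. finite (V k)" and ne: "\<And>k. V k \<noteq> {}"
    and maps: "\<And>k. f ` V (Suc k) \<subseteq> V k"
    and coal: "\<And>n. \<exists>m\<ge>n. card ((f ^^ (m - n)) ` V m) < 2"
  shows "card (ancestral_lines V f) = 1"
proof -
  have "x = y" if xy: "x \<in> ancestral_lines V f" "y \<in> ancestral_lines V f" for x y
  proof
    fix n
    obtain m where m: "m \<ge> n" "card ((f ^^ (m - n)) ` V m) < 2" using coal by blast
    have xn: "x n = (f ^^ (m - n)) (x m)" and yn: "y n = (f ^^ (m - n)) (y m)"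
      using funpow_line[OF xy(1), of "m - n" n] funpow_line[OF xy(2), of "m - n" n] m(1) by auto
    have "x m \<in> V m" "y m \<in> V m" using xy by (auto simp: ancestral_lines_def)
    moreover have "\<forall>a\<in>(f ^^ (m - n)) ` V m. \<forall>b\<in>(f ^^ (m - n)) ` V m. a = b"
      using m(2) fin[of m] by (subst card_le_Suc0_iff_eq[symmetric]) auto
    ultimately show "x n = y n"
      unfolding xn yn by blast
  qed
  moreover obtain x where "x \<in> ancestral_lines V f" using ancestral_lines_nonempty[of V f, OF fin ne maps] by blast
  ultimately have "ancestral_lines V f = {x}" by blast
  then show ?thesis by simp
qed

text \<open>The proportion of ordered pairs on level \<open>m\<close> with a common ancestor on level \<open>n\<close>. It is the sum
  of the squared proportions of descendants of the vertices on level \<open>n\<close>, and its expectation only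
  requires following two vertices at a time.\<close>
definition kin_fraction :: "(nat \<Rightarrow> 'v set) \<Rightarrow> ('v \<Rightarrow> 'v) \<Rightarrow> nat \<Rightarrow> nat \<Rightarrow> real" where
  "kin_fraction V f n m =
     (\<Sum>x\<in>V m. \<Sum>y\<in>V m. of_bool ((f ^^ (m - n)) x = (f ^^ (m - n)) y)) / (real (card (V m)))\<^sup>2"

lemma descendants_le_kin_fraction:
  assumes "finite (V m)"
  shows "(real (card {x \<in> V m. (f ^^ (m - n)) x = v}) / real (card (V m)))\<^sup>2 \<le> kin_fraction V f n m"
proof -
  let ?g = "f ^^ (m - n)" and ?D = "{x \<in> V m. (f ^^ (m - n)) x = v}"
  have "(real (card ?D))\<^sup>2 = (\<Sum>x\<in>?D. \<Sum>y\<in>?D. of_bool (?g x = ?g y))"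
    by (simp add: power2_eq_square)
  also have "\<dots> \<le> (\<Sum>x\<in>?D. \<Sum>y\<in>V m. of_bool (?g x = ?g y))"
    using assms by (intro sum_mono sum_mono2) auto
  also have "\<dots> \<le> (\<Sum>x\<in>V m. \<Sum>y\<in>V m. of_bool (?g x = ?g y))"
    using assms by (intro sum_mono2) (auto intro: sum_nonneg)
  finally show ?thesis
    unfolding kin_fraction_def power_divide by (intro divide_right_mono) auto
qed

lemma sum_half_powers_le:
  assumes "finite I"
  shows "(\<Sum>i\<in>I. 1 / 2 ^ (i + 2) :: real) \<le> 1 / 2"
proof -
  have s: "(\<lambda>i. 1 / 2 ^ (i + 2) :: real) sums (1 / 2)"
    using sums_mult[OF geometric_sums[of "1/2 :: real"], of "1/4"]
    by (simp add: power_divide field_simps)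
  have "(\<Sum>i\<in>I. 1 / 2 ^ (i + 2) :: real) \<le> suminf (\<lambda>i. 1 / 2 ^ (i + 2))"
    using s \<open>finite I\<close> by (intro sum_le_suminf) (auto simp: sums_iff)
  with s show ?thesis by (simp add: sums_iff)
qed

text \<open>A diagonal argument. Suppose that \<open>p\<close> enumerates the lines. The line \<open>p i\<close> is cut at the level
  \<open>n i = r (j i)\<close>, chosen so high that on infinitely many levels the descendants of the cut vertex make
  up a proportion of at most \<open>1 / 2 ^ (i + 2)\<close>. These proportions sum to at most one half, so the
  vertices that descend from no cut vertex form a tree that reaches infinitely many levels, hence all
  of them. A line in this tree avoids the cut vertex of every \<open>p i\<close>.\<close>
lemma uncountable_ancestral_lines:
  assumes fin: "\<And>k. finite (V k)" and ne: "\<And>k. V k \<noteq> {}"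
    and maps: "\<And>k. f ` V (Suc k) \<subseteq> V k"
    and spread: "\<exists>\<^sub>\<infinity>m. \<forall>j. r j \<le> m \<longrightarrow> kin_fraction V f (r j) m \<le> C / 2 ^ j"
  shows "uncountable (ancestral_lines V f)"
proof
  assume "countable (ancestral_lines V f)"
  moreover have "ancestral_lines V f \<noteq> {}" by (rule ancestral_lines_nonempty[of V f, OF fin ne maps])
  ultimately have "range (from_nat_into (ancestral_lines V f)) = ancestral_lines V f" by (intro range_from_nat_into)
  then obtain p :: "nat \<Rightarrow> nat \<Rightarrow> 'a" where p: "ancestral_lines V f = range p" by metis
  have "\<exists>j. C / 2 ^ j \<le> (1 / 2 ^ (i + 2))\<^sup>2" for i :: nat
  proof -
    have "(\<lambda>j. C / 2 ^ j) \<longlonglongrightarrow> 0" by real_asymp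
    then have "\<forall>\<^sub>F j in sequentially. C / 2 ^ j < (1 / 2 ^ (i + 2))\<^sup>2"
      by (rule order_tendstoD) simp
    from eventually_happens[OF this] show ?thesis by (auto intro: less_imp_le)
  qed
  then obtain j where j: "\<And>i. C / 2 ^ j i \<le> (1 / 2 ^ (i + 2))\<^sup>2" by metis
  define n where "n i = r (j i)" for i
  define D where "D i m = {x \<in> V m. (f ^^ (m - n i)) x = p i (n i)}" for i m
  define U where "U m = {x \<in> V m. \<forall>i. n i \<le> m \<longrightarrow> x \<notin> D i m}" for m
  have mapsU: "f ` U (Suc m) \<subseteq> U m" for m
  proof
    fix y assume "y \<in> f ` U (Suc m)"
    then obtain x where x: "x \<in> U (Suc m)" "y = f x" by blast
    have "y \<in> V m" using x maps by (auto simp: U_def)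
    moreover have "y \<notin> D i m" if "n i \<le> m" for i
    proof
      assume "y \<in> D i m"
      then have "(f ^^ (Suc m - n i)) x = p i (n i)"
        using that x(2) by (simp add: D_def Suc_diff_le funpow_swap1)
      then have "x \<in> D i (Suc m)" using x by (simp add: D_def U_def)
      with x(1) that show False by (simp add: U_def)
    qed
    ultimately show "y \<in> U m" by (simp add: U_def)
  qed
  have neU: "U m \<noteq> {}" for m
  proof -
    obtain m' where m': "m' \<ge> m" "\<And>j. r j \<le> m' \<Longrightarrow> kin_fraction V f (r j) m' \<le> C / 2 ^ j"
      using spread by (auto simp: INFM_nat_le)
    have "U m' \<noteq> {}"
    proof
      assume "U m' = {}"
      then have "\<forall>x\<in>V m'. \<exists>i. n i \<le> m' \<and> x \<in> D i m'" by (auto simp: U_def)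
      then obtain c where c: "\<And>x. x \<in> V m' \<Longrightarrow> n (c x) \<le> m' \<and> x \<in> D (c x) m'" by metis
      \<comment> \<open>Only the finitely many lines with index in \<open>c ` V m'\<close> are needed to cover level \<open>m'\<close>.\<close>
      let ?N = "real (card (V m'))"
      have pos: "?N > 0" using fin ne by (simp add: card_gt_0_iff)
      have small: "real (card (D i m')) / ?N \<le> 1 / 2 ^ (i + 2)" if "n i \<le> m'" for i
      proof -
        have "(real (card (D i m')) / ?N)\<^sup>2 \<le> kin_fraction V f (n i) m'"
          unfolding D_def by (rule descendants_le_kin_fraction[OF fin])
        also have "\<dots> \<le> C / 2 ^ j i" using m'(2) that by (simp add: n_def)
        also have "\<dots> \<le> (1 / 2 ^ (i + 2))\<^sup>2" by (rule j)
        finally show ?thesis by (rule power2_le_imp_le) simp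
      qed
      have "V m' \<subseteq> (\<Union>i\<in>c ` V m'. D i m')" using c by blast
      then have "card (V m') \<le> card (\<Union>i\<in>c ` V m'. D i m')"
        using fin by (intro card_mono) (auto simp: D_def)
      also have "\<dots> \<le> (\<Sum>i\<in>c ` V m'. card (D i m'))"
        using fin by (intro card_UN_le) auto
      finally have "?N \<le> (\<Sum>i\<in>c ` V m'. real (card (D i m')))"
        by (metis of_nat_le_iff of_nat_sum)
      then have "1 \<le> (\<Sum>i\<in>c ` V m'. real (card (D i m')) / ?N)"
        using pos by (simp add: sum_divide_distrib[symmetric])
      also have "\<dots> \<le> (\<Sum>i\<in>c ` V m'. 1 / 2 ^ (i + 2))"
        using c by (intro sum_mono small) auto
      also have "\<dots> \<le> 1 / 2" using fin by (intro sum_half_powers_le) auto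
      finally show False by simp
    qed
    then obtain x where "x \<in> U m'" by blast
    then have "(f ^^ (m' - m)) x \<in> U m"
      using funpow_level[of f U x m "m' - m"] mapsU m'(1) by simp
    then show ?thesis by blast
  qed
  have "finite (U m)" for m using fin by (simp add: U_def)
  then obtain x where x: "x \<in> ancestral_lines U f" using ancestral_lines_nonempty[of U f] neU mapsU by blast
  then have "x \<in> ancestral_lines V f" by (auto simp: ancestral_lines_def U_def)
  then obtain i where i: "x = p i" using p by blast
  have "x (n i) \<in> U (n i)" using x by (simp add: ancestral_lines_def)
  moreover have "x (n i) \<in> D i (n i)" using \<open>x \<in> ancestral_lines V f\<close> i by (simp add: D_def ancestral_lines_def)
  ultimately show False by (simp add: U_def)
qed

section \<open>Occupied boxes\<close>

text \<open>With \<open>x = 1 / M\<close>, the left-hand side times \<open>M\<close> is the expected number of occupied boxes after \<open>a\<close>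
  balls are thrown into \<open>M\<close> boxes. The bound says that its reciprocal is at least
  \<open>1 / a + 1 / (4 M)\<close>. It fails for \<open>a = 1\<close> and \<open>x > 0\<close>, so the induction starts at \<open>a = 2\<close>, which is where the
  constant \<open>1 / 4\<close> comes from.\<close>
lemma occupancy_bound:
  fixes x :: real
  assumes "0 \<le> x" "x \<le> 1" "2 \<le> a"
  shows "1 - (1 - x) ^ a \<le> a * x / (1 + a * x / 4)"
  using \<open>2 \<le> a\<close>
proof (induction a rule: nat_induct_at_least)
  case base
  have "(1 - (1 - x)\<^sup>2) * (1 + x / 2) = 2 * x - x ^ 3 / 2" by (simp add: algebra_simps power2_eq_square power3_eq_cube)
  also have "\<dots> \<le> 2 * x" using assms by simp
  finally show ?case using assms by (simp add: field_simps)
next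
  case (Suc a)
  define b c where "b = 1 + a * x / 4" and "c = 1 + Suc a * x / 4"
  have pos: "b > 0" "c > 0" using assms by (auto simp: b_def c_def intro: add_pos_nonneg)
  have "real (Suc a) * x * b - (x * b + (1 - x) * (a * x)) * c
      = x * (x * (a / 2 - 1 / 4) + 3 / 16 * a * Suc a * x\<^sup>2)"
    by (simp add: b_def c_def field_simps power2_eq_square)
  moreover have "0 \<le> x * (x * (a / 2 - 1 / 4) + 3 / 16 * a * Suc a * x\<^sup>2)"
    using assms Suc.hyps by (intro mult_nonneg_nonneg add_nonneg_nonneg) auto
  ultimately have key: "(x * b + (1 - x) * (a * x)) * c \<le> real (Suc a) * x * b" by linarith
  have "1 - (1 - x) ^ Suc a = x + (1 - x) * (1 - (1 - x) ^ a)" by (simp add: algebra_simps)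
  also have "\<dots> \<le> x + (1 - x) * (a * x / b)"
    using Suc.IH assms by (intro add_left_mono mult_left_mono) (auto simp: b_def)
  also have "\<dots> = (x * b + (1 - x) * (a * x)) / b" using pos by (simp add: field_simps)
  also have "\<dots> \<le> Suc a * x / c" using key pos by (simp add: divide_le_eq le_divide_eq)
  finally show ?case by (simp add: c_def)
qed

section \<open>Independent uniform parents\<close>

locale random_genealogy = prob_space M for M :: "'w measure" +
  fixes V :: "nat \<Rightarrow> 'v set" and \<phi> :: "'w \<Rightarrow> 'v \<Rightarrow> 'v"
  assumes finite_level: "\<And>k. finite (V k)"
    and level_nonempty: "\<And>k. V k \<noteq> {}"
    and disjoint_levels: "disjoint_family V"
    and parent_level: "\<And>\<omega> k v. \<omega> \<in> space M \<Longrightarrow> v \<in> V (Suc k) \<Longrightarrow> \<phi> \<omega> v \<in> V k"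
    and indep_parents: "indep_vars (\<lambda>_. count_space UNIV) (\<lambda>v \<omega>. \<phi> \<omega> v) (\<Union>k. V (Suc k))"
    and uniform_parent:
      "\<And>k v w. v \<in> V (Suc k) \<Longrightarrow> w \<in> V k \<Longrightarrow> prob {\<omega> \<in> space M. \<phi> \<omega> v = w} = 1 / card (V k)"
begin

abbreviation children :: "'v set" where
  "children \<equiv> (\<Union>k. V (Suc k))"

lemma parent_maps: "\<omega> \<in> space M \<Longrightarrow> \<phi> \<omega> ` V (Suc k) \<subseteq> V k"
  using parent_level by blast

lemma parent_event [measurable]: "v \<in> children \<Longrightarrow> {\<omega> \<in> space M. \<phi> \<omega> v \<in> A} \<in> events"
proof -
  assume v: "v \<in> children"
  have "random_variable (count_space UNIV) (\<lambda>\<omega>. \<phi> \<omega> v)"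
    using indep_parents v unfolding indep_vars_def2 by blast
  from measurable_sets[OF this, of A] show ?thesis by (simp add: vimage_def Int_def conj_commute)
qed

lemma prob_all_parents:
  assumes "finite J" "J \<subseteq> children"
  shows "prob {\<omega> \<in> space M. \<forall>v\<in>J. \<phi> \<omega> v \<in> A v} = (\<Prod>v\<in>J. prob {\<omega> \<in> space M. \<phi> \<omega> v \<in> A v})"
proof (cases "J = {}")
  case False
  have "{\<omega> \<in> space M. \<forall>v\<in>J. \<phi> \<omega> v \<in> A v} = (\<Inter>v\<in>J. (\<lambda>\<omega>. \<phi> \<omega> v) -` A v \<inter> space M)"
    using False by auto
  moreover have "{\<omega> \<in> space M. \<phi> \<omega> v \<in> A v} = (\<lambda>\<omega>. \<phi> \<omega> v) -` A v \<inter> space M" for v by auto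
  ultimately show ?thesis
    using indep_varsD[OF indep_parents False assms, of A] by simp
qed (simp add: prob_space)

text \<open>The random variables of interest depend only on the parents of finitely many vertices. They take
  finitely many values, which settles measurability and integrability and turns expectations into
  finite sums over the possible values of those parents.\<close>
definition determined :: "'v set \<Rightarrow> ('w \<Rightarrow> 'b) \<Rightarrow> bool" where
  "determined J F \<longleftrightarrow>
     (\<forall>\<omega>\<in>space M. \<forall>\<omega>'\<in>space M. (\<forall>v\<in>J. \<phi> \<omega> v = \<phi> \<omega>' v) \<longrightarrow> F \<omega> = F \<omega>')"

lemma determinedI:
  assumes "\<And>\<omega> \<omega>'. \<omega> \<in> space M \<Longrightarrow> \<omega>' \<in> space M \<Longrightarrow> (\<And>v. v \<in> J \<Longrightarrow> \<phi> \<omega> v = \<phi> \<omega>' v) \<Longrightarrow> F \<omega> = F \<omega>'"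
  shows "determined J F"
  using assms unfolding determined_def by blast

lemma determinedD:
  "determined J F \<Longrightarrow> \<omega> \<in> space M \<Longrightarrow> \<omega>' \<in> space M \<Longrightarrow> (\<And>v. v \<in> J \<Longrightarrow> \<phi> \<omega> v = \<phi> \<omega>' v) \<Longrightarrow> F \<omega> = F \<omega>'"
  unfolding determined_def by blast

definition atom :: "'v set \<Rightarrow> ('v \<Rightarrow> 'v) \<Rightarrow> 'w set" where
  "atom J g = {\<omega> \<in> space M. \<forall>v\<in>J. \<phi> \<omega> v = g v}"

definition patterns :: "'v set \<Rightarrow> ('v \<Rightarrow> 'v) set" where
  "patterns J = (\<lambda>\<omega>. restrict (\<phi> \<omega>) J) ` space M"

text \<open>A random variable determined by \<open>J\<close> is constant on the atoms of \<open>J\<close>, and \<open>rep\<close> picks a point at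
  which to read off its value. It is meaningful only for patterns, whose atoms are nonempty.\<close>
definition rep :: "'v set \<Rightarrow> ('v \<Rightarrow> 'v) \<Rightarrow> 'w" where
  "rep J g = (SOME \<omega>. \<omega> \<in> atom J g)"

lemma finite_patterns:
  assumes "finite J" "J \<subseteq> children"
  shows "finite (patterns J)"
proof (rule finite_subset)
  define lev where "lev v = (SOME k. v \<in> V (Suc k))" for v
  have lev: "v \<in> V (Suc (lev v))" if "v \<in> J" for v
    unfolding lev_def by (rule someI_ex) (use that assms in auto)
  show "patterns J \<subseteq> Pi\<^sub>E J (\<lambda>v. V (lev v))"
    unfolding patterns_def using parent_level lev by fastforce
  show "finite (Pi\<^sub>E J (\<lambda>v. V (lev v)))"
    using assms finite_level by (intro finite_PiE) auto
qed

lemma rep_atom: "g \<in> patterns J \<Longrightarrow> rep J g \<in> atom J g"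
  unfolding rep_def by (rule someI_ex) (auto simp: patterns_def atom_def)

lemma atom_event: "finite J \<Longrightarrow> J \<subseteq> children \<Longrightarrow> atom J g \<in> events"
proof -
  assume J: "finite J" "J \<subseteq> children"
  have "{\<omega> \<in> space M. \<phi> \<omega> v = g v} \<in> events" if "v \<in> J" for v
    using parent_event[of v "{g v}"] that J by auto
  then show ?thesis unfolding atom_def using J by (intro sets.sets_Collect_finite_All) auto
qed

lemma atom_expansion:
  fixes F :: "'w \<Rightarrow> real"
  assumes J: "finite J" "J \<subseteq> children" and F: "determined J F" and \<omega>: "\<omega> \<in> space M"
  shows "F \<omega> = (\<Sum>g\<in>patterns J. indicator (atom J g) \<omega> * F (rep J g))"
proof -
  have "(\<Sum>g\<in>patterns J. indicator (atom J g) \<omega> * F (rep J g))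
      = (\<Sum>g\<in>patterns J. if g = restrict (\<phi> \<omega>) J then F \<omega> else 0)"
  proof (rule sum.cong)
    fix g assume g: "g \<in> patterns J"
    show "indicator (atom J g) \<omega> * F (rep J g) = (if g = restrict (\<phi> \<omega>) J then F \<omega> else 0)"
    proof (cases "g = restrict (\<phi> \<omega>) J")
      case True
      then have "\<omega> \<in> atom J g" using \<omega> by (simp add: atom_def)
      moreover have "F (rep J g) = F \<omega>"
        using rep_atom[OF g] \<omega> True by (intro determinedD[OF F]) (auto simp: atom_def)
      ultimately show ?thesis using True by simp
    next
      case False
      have "\<omega> \<notin> atom J g"
      proof
        assume "\<omega> \<in> atom J g"
        moreover have "g \<in> extensional J" using g by (auto simp: patterns_def)
        ultimately have "g = restrict (\<phi> \<omega>) J"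
          by (intro extensionalityI[of _ J]) (auto simp: atom_def)
        with False show False ..
      qed
      then show ?thesis using False by simp
    qed
  qed simp
  also have "\<dots> = F \<omega>"
    using finite_patterns[OF J] \<omega> by (subst sum.delta) (auto simp: patterns_def)
  finally show ?thesis by simp
qed

lemma determined_measurable:
  fixes F :: "'w \<Rightarrow> real"
  assumes J: "finite J" "J \<subseteq> children" and F: "determined J F"
  shows "F \<in> borel_measurable M"
proof -
  have "(\<lambda>\<omega>. \<Sum>g\<in>patterns J. indicator (atom J g) \<omega> * F (rep J g)) \<in> borel_measurable M"
    using atom_event[OF J] by (intro borel_measurable_sum borel_measurable_times borel_measurable_indicator) auto
  then show ?thesis
    using atom_expansion[OF J F] by (subst measurable_cong) auto
qed

lemma determined_integrable:
  fixes F :: "'w \<Rightarrow> real"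
  assumes J: "finite J" "J \<subseteq> children" and F: "determined J F"
  shows "integrable M F"
proof (rule integrable_const_bound)
  show "AE \<omega> in M. norm (F \<omega>) \<le> (\<Sum>g\<in>patterns J. \<bar>F (rep J g)\<bar>)"
  proof (rule AE_I2)
    fix \<omega> assume "\<omega> \<in> space M"
    from atom_expansion[OF J F this]
    have "\<bar>F \<omega>\<bar> \<le> (\<Sum>g\<in>patterns J. \<bar>indicator (atom J g) \<omega> * F (rep J g)\<bar>)"
      by (metis sum_abs)
    also have "\<dots> \<le> (\<Sum>g\<in>patterns J. \<bar>F (rep J g)\<bar>)"
      by (intro sum_mono) (simp add: indicator_def)
    finally show "norm (F \<omega>) \<le> (\<Sum>g\<in>patterns J. \<bar>F (rep J g)\<bar>)" by simp
  qed
qed (rule determined_measurable[OF assms])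

lemma expectation_determined:
  fixes F :: "'w \<Rightarrow> real"
  assumes J: "finite J" "J \<subseteq> children" and F: "determined J F"
  shows "expectation F = (\<Sum>g\<in>patterns J. prob (atom J g) * F (rep J g))"
proof -
  have "expectation F = expectation (\<lambda>\<omega>. \<Sum>g\<in>patterns J. indicator (atom J g) \<omega> * F (rep J g))"
    using atom_expansion[OF J F] by (intro Bochner_Integration.integral_cong) auto
  also have "\<dots> = (\<Sum>g\<in>patterns J. expectation (\<lambda>\<omega>. indicator (atom J g) \<omega> * F (rep J g)))"
    using atom_event[OF J] by (intro Bochner_Integration.integral_sum) (auto simp: emeasure_eq_measure)
  also have "\<dots> = (\<Sum>g\<in>patterns J. prob (atom J g) * F (rep J g))"
    using atom_event[OF J] by (simp add: emeasure_eq_measure)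
  finally show ?thesis .
qed

lemma prob_atom_inter:
  assumes J: "finite J" "J \<subseteq> children" and K: "finite K" "K \<subseteq> children" and "J \<inter> K = {}"
  shows "prob (atom J g \<inter> atom K h) = prob (atom J g) * prob (atom K h)"
proof -
  define A where "A v = (if v \<in> J then {g v} else {h v})" for v
  have A: "A v = {h v}" if "v \<in> K" for v using that \<open>J \<inter> K = {}\<close> by (auto simp: A_def)
  have atomJ: "atom J g = {\<omega> \<in> space M. \<forall>v\<in>J. \<phi> \<omega> v \<in> A v}" by (auto simp: atom_def A_def)
  moreover have atomK: "atom K h = {\<omega> \<in> space M. \<forall>v\<in>K. \<phi> \<omega> v \<in> A v}" using A by (auto simp: atom_def)
  moreover have "atom J g \<inter> atom K h = {\<omega> \<in> space M. \<forall>v\<in>J \<union> K. \<phi> \<omega> v \<in> A v}"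
    unfolding atomJ atomK by blast
  moreover have "(\<Prod>v\<in>J \<union> K. prob {\<omega> \<in> space M. \<phi> \<omega> v \<in> A v})
      = (\<Prod>v\<in>J. prob {\<omega> \<in> space M. \<phi> \<omega> v \<in> A v}) * (\<Prod>v\<in>K. prob {\<omega> \<in> space M. \<phi> \<omega> v \<in> A v})"
    using J K \<open>J \<inter> K = {}\<close> by (intro prod.union_disjoint) auto
  ultimately show ?thesis
    using prob_all_parents[of "J \<union> K" A] prob_all_parents[of J A] prob_all_parents[of K A] J K by simp
qed

text \<open>Fubini's theorem for the parents of two disjoint sets of vertices: \<open>H\<close> sees the first set through
  its first argument and the second set through its second argument, so the second argument may be
  replaced by an independent copy. This is the Markov property of the ancestral process.\<close>
lemma expectation_resample:
  fixes H :: "'w \<Rightarrow> 'w \<Rightarrow> real"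
  assumes J: "finite J" "J \<subseteq> children" and K: "finite K" "K \<subseteq> children" and disj: "J \<inter> K = {}"
    and H1: "\<And>\<omega>'. \<omega>' \<in> space M \<Longrightarrow> determined J (\<lambda>\<omega>. H \<omega> \<omega>')"
    and H2: "\<And>\<omega>. \<omega> \<in> space M \<Longrightarrow> determined K (H \<omega>)"
  shows "expectation (\<lambda>\<omega>. H \<omega> \<omega>) = expectation (\<lambda>\<omega>. expectation (H \<omega>))"
proof -
  have rep_space: "rep J g \<in> space M" if "g \<in> patterns J" for g J
    using rep_atom[OF that] by (simp add: atom_def)
  have "expectation (\<lambda>\<omega>. H \<omega> \<omega>)
      = expectation (\<lambda>\<omega>. \<Sum>g\<in>patterns J. \<Sum>h\<in>patterns K.
          indicator (atom J g \<inter> atom K h) \<omega> * H (rep J g) (rep K h))"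
  proof (rule Bochner_Integration.integral_cong)
    fix \<omega> assume \<omega>: "\<omega> \<in> space M"
    have "H \<omega> \<omega> = (\<Sum>g\<in>patterns J. indicator (atom J g) \<omega> * H (rep J g) \<omega>)"
      using atom_expansion[OF J H1[OF \<omega>] \<omega>] .
    also have "\<dots> = (\<Sum>g\<in>patterns J. indicator (atom J g) \<omega> *
        (\<Sum>h\<in>patterns K. indicator (atom K h) \<omega> * H (rep J g) (rep K h)))"
    proof (rule sum.cong)
      fix g assume "g \<in> patterns J"
      from atom_expansion[OF K H2[OF rep_space[OF this]] \<omega>]
      show "indicator (atom J g) \<omega> * H (rep J g) \<omega> = indicator (atom J g) \<omega> *
          (\<Sum>h\<in>patterns K. indicator (atom K h) \<omega> * H (rep J g) (rep K h))" by simp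
    qed simp
    also have "\<dots> = (\<Sum>g\<in>patterns J. \<Sum>h\<in>patterns K.
          indicator (atom J g \<inter> atom K h) \<omega> * H (rep J g) (rep K h))"
      unfolding sum_distrib_left by (intro sum.cong refl) (simp add: indicator_inter_arith)
    finally show "H \<omega> \<omega> = (\<Sum>g\<in>patterns J. \<Sum>h\<in>patterns K.
          indicator (atom J g \<inter> atom K h) \<omega> * H (rep J g) (rep K h))" .
  qed simp
  also have "\<dots> = (\<Sum>g\<in>patterns J. \<Sum>h\<in>patterns K.
      prob (atom J g \<inter> atom K h) * H (rep J g) (rep K h))"
  proof -
    have ev: "atom J g \<inter> atom K h \<in> events" for g h
      using atom_event[OF J] atom_event[OF K] by (rule sets.Int)
    have int: "integrable M (\<lambda>\<omega>. indicator (atom J g \<inter> atom K h) \<omega> * H (rep J g) (rep K h))" for g h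
      using ev by (intro integrable_mult_left integrable_real_indicator) (auto simp: emeasure_eq_measure)
    have "expectation (\<lambda>\<omega>. indicator (atom J g \<inter> atom K h) \<omega> * H (rep J g) (rep K h))
        = prob (atom J g \<inter> atom K h) * H (rep J g) (rep K h)" for g h
      using sets.sets_into_space[OF ev, of g h] by (simp add: Int_absorb2)
    moreover have "atom J g \<inter> atom K h \<inter> space M = atom J g \<inter> atom K h" for g h
      using sets.sets_into_space[OF ev, of g h] by blast
    ultimately show ?thesis using int by (simp add: Bochner_Integration.integral_sum)
  qed
  also have "\<dots> = (\<Sum>g\<in>patterns J. prob (atom J g) *
      (\<Sum>h\<in>patterns K. prob (atom K h) * H (rep J g) (rep K h)))"
    unfolding prob_atom_inter[OF J K disj] sum_distrib_left by (simp only: mult.assoc)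
  also have "\<dots> = (\<Sum>g\<in>patterns J. prob (atom J g) * expectation (H (rep J g)))"
    using expectation_determined[OF K H2[OF rep_space]] by (intro sum.cong refl) simp
  also have "\<dots> = expectation (\<lambda>\<omega>. expectation (H \<omega>))"
  proof (rule expectation_determined[OF J, symmetric], rule determinedI)
    fix \<omega> \<omega>' assume "\<omega> \<in> space M" "\<omega>' \<in> space M" "\<And>v. v \<in> J \<Longrightarrow> \<phi> \<omega> v = \<phi> \<omega>' v"
    then have "H \<omega> \<omega>'' = H \<omega>' \<omega>''" if "\<omega>'' \<in> space M" for \<omega>''
      using determinedD[OF H1[OF that]] by blast
    then show "expectation (H \<omega>) = expectation (H \<omega>')"
      by (intro Bochner_Integration.integral_cong) auto
  qed
  finally show ?thesis .
qed

abbreviation levels_between :: "nat \<Rightarrow> nat \<Rightarrow> 'v set" where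
  "levels_between n m \<equiv> (\<Union>i\<in>{n<..m}. V i)"

lemma levels_between_children: "finite (levels_between n m)" "levels_between n m \<subseteq> children"
proof -
  show "finite (levels_between n m)" using finite_level by simp
  show "levels_between n m \<subseteq> children"
  proof (rule UN_least)
    fix i assume "i \<in> {n<..m}"
    then show "V i \<subseteq> children" by (cases i) auto
  qed
qed

lemma level_children: "finite (V (Suc k))" "V (Suc k) \<subseteq> children"
  using finite_level[of "Suc k"] by auto

lemma level_disjoint_above: "levels_between (Suc k) m \<inter> V (Suc k) = {}"
proof -
  have "V i \<inter> V (Suc k) = {}" if "i \<in> {Suc k<..m}" for i
    using disjoint_levels that unfolding disjoint_family_on_def by simp
  then show ?thesis by blast
qed

lemma determined_comp:
  assumes "determined J F"
  shows "determined J (\<lambda>\<omega>. G (F \<omega>))"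
  by (rule determinedI) (rule arg_cong[where f = G], rule determinedD[OF assms])

lemma determined_event:
  assumes "finite J" "J \<subseteq> children" "determined J P"
  shows "{\<omega> \<in> space M. P \<omega>} \<in> events"
    and "expectation (\<lambda>\<omega>. of_bool (P \<omega>)) = prob {\<omega> \<in> space M. P \<omega>}"
proof -
  have "(\<lambda>\<omega>. of_bool (P \<omega>) :: real) \<in> borel_measurable M"
    by (rule determined_measurable[OF assms(1,2) determined_comp[OF assms(3)]])
  from measurable_sets[OF this, of "{1}"]
  show ev: "{\<omega> \<in> space M. P \<omega>} \<in> events" by (simp add: vimage_def Int_def conj_commute)
  have "expectation (\<lambda>\<omega>. of_bool (P \<omega>)) = expectation (indicator {\<omega> \<in> space M. P \<omega>})"
    by (intro Bochner_Integration.integral_cong) (auto simp: indicator_def)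
  also have "\<dots> = prob {\<omega> \<in> space M. P \<omega>}"
    using sets.sets_into_space[OF ev] by (simp add: Int_absorb2)
  finally show "expectation (\<lambda>\<omega>. of_bool (P \<omega>)) = prob {\<omega> \<in> space M. P \<omega>}" .
qed

text \<open>The path from level \<open>m\<close> down to level \<open>n\<close> asks for parents on the levels above \<open>n\<close> only; hence
  the half-open range of levels.\<close>
lemma determined_ancestor:
  assumes "x \<in> V m" "n \<le> m"
  shows "determined (levels_between n m) (\<lambda>\<omega>. (\<phi> \<omega> ^^ (m - n)) x)"
proof -
  have same: "(\<phi> \<omega> ^^ d) x = (\<phi> \<omega>' ^^ d) x"
    if "\<omega> \<in> space M" "\<omega>' \<in> space M" "x \<in> V (n + d)"
      and "\<And>v. v \<in> levels_between n (n + d) \<Longrightarrow> \<phi> \<omega> v = \<phi> \<omega>' v" for \<omega> \<omega>' x and d :: nat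
    using that(3,4)
  proof (induction d arbitrary: x)
    case (Suc d)
    have "\<phi> \<omega> x = \<phi> \<omega>' x" using Suc.prems(1) by (intro Suc.prems(2)) auto
    moreover have "(\<phi> \<omega> ^^ d) (\<phi> \<omega> x) = (\<phi> \<omega>' ^^ d) (\<phi> \<omega> x)"
    proof (rule Suc.IH)
      show "\<phi> \<omega> x \<in> V (n + d)" using Suc.prems(1) parent_level[OF \<open>\<omega> \<in> space M\<close>, of x "n + d"] by simp
      show "\<phi> \<omega> v = \<phi> \<omega>' v" if "v \<in> levels_between n (n + d)" for v
        using that by (intro Suc.prems(2)) auto
    qed
    ultimately show ?case by (simp add: funpow_swap1)
  qed simp
  have "n + (m - n) = m" using assms(2) by simp
  then show ?thesis
    using assms(1) by (intro determinedI same) simp_all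
qed

lemma determined_ancestors:
  assumes "n \<le> m"
  shows "determined (levels_between n m) (\<lambda>\<omega>. (\<phi> \<omega> ^^ (m - n)) ` V m)"
proof (rule determinedI)
  fix \<omega> \<omega>' assume "\<omega> \<in> space M" "\<omega>' \<in> space M" "\<And>v. v \<in> levels_between n m \<Longrightarrow> \<phi> \<omega> v = \<phi> \<omega>' v"
  then have "(\<phi> \<omega> ^^ (m - n)) x = (\<phi> \<omega>' ^^ (m - n)) x" if "x \<in> V m" for x
    by (rule determinedD[OF determined_ancestor[OF that assms]])
  then show "(\<phi> \<omega> ^^ (m - n)) ` V m = (\<phi> \<omega>' ^^ (m - n)) ` V m" by (rule image_cong[OF refl])
qed

lemma ancestors_level:
  assumes "\<omega> \<in> space M" "n \<le> m"
  shows "(\<phi> \<omega> ^^ (m - n)) ` V m \<subseteq> V n"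
proof
  fix y assume "y \<in> (\<phi> \<omega> ^^ (m - n)) ` V m"
  then obtain x where x: "x \<in> V (n + (m - n))" "y = (\<phi> \<omega> ^^ (m - n)) x" using assms(2) by auto
  show "y \<in> V n"
    unfolding x(2) by (rule funpow_level[OF parent_maps[OF assms(1)] x(1)])
qed

lemma ancestor_step: "n < m \<Longrightarrow> (f ^^ (m - n)) x = f ((f ^^ (m - Suc n)) x)" for f :: "'v \<Rightarrow> 'v"
  by (metis Suc_diff_Suc comp_apply funpow.simps(2))

lemma card_level_pos: "card (V k) > 0"
  using finite_level level_nonempty by (simp add: card_gt_0_iff)

text \<open>By linearity of expectation over the vertices of level \<open>k\<close>: each of them is missed by all members
  of \<open>s\<close> with probability \<open>(1 - 1 / M) ^ card s\<close>.\<close>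
lemma expected_number_of_parents:
  assumes s: "s \<subseteq> V (Suc k)"
  shows "expectation (\<lambda>\<omega>. real (card (\<phi> \<omega> ` s)))
    = card (V k) * (1 - (1 - 1 / card (V k)) ^ card s)"
proof -
  have fin: "finite s" using s finite_level by (rule finite_subset)
  have sb: "s \<subseteq> children" using s by blast
  have det: "determined s (\<lambda>\<omega>. w \<in> \<phi> \<omega> ` s)" for w
    by (intro determinedI) (auto simp: image_iff)
  have hit: "expectation (\<lambda>\<omega>. of_bool (w \<in> \<phi> \<omega> ` s)) = 1 - (1 - 1 / card (V k)) ^ card s"
    if w: "w \<in> V k" for w
  proof -
    have miss1: "prob {\<omega> \<in> space M. \<phi> \<omega> v \<in> - {w}} = 1 - 1 / card (V k)" if "v \<in> s" for v
    proof -
      have "{\<omega> \<in> space M. \<phi> \<omega> v \<in> - {w}} = space M - {\<omega> \<in> space M. \<phi> \<omega> v = w}" by auto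
      moreover have "{\<omega> \<in> space M. \<phi> \<omega> v = w} \<in> events"
        using parent_event[of v "{w}"] that sb by auto
      ultimately show ?thesis
        using uniform_parent[of v k w] that s w by (simp add: prob_compl subset_iff)
    qed
    have "{\<omega> \<in> space M. w \<in> \<phi> \<omega> ` s} = space M - {\<omega> \<in> space M. \<forall>v\<in>s. \<phi> \<omega> v \<in> - {w}}" by auto
    moreover have "determined s (\<lambda>\<omega>. \<forall>v\<in>s. \<phi> \<omega> v \<in> - {w})"
      by (intro determinedI) auto
    then have "{\<omega> \<in> space M. \<forall>v\<in>s. \<phi> \<omega> v \<in> - {w}} \<in> events"
      by (rule determined_event(1)[OF fin sb])
    moreover have "prob {\<omega> \<in> space M. \<forall>v\<in>s. \<phi> \<omega> v \<in> - {w}} = (1 - 1 / card (V k)) ^ card s"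
      using prob_all_parents[OF fin sb, of "\<lambda>_. - {w}"] miss1 by simp
    ultimately show ?thesis
      using determined_event(2)[OF fin sb det[of w]] by (simp add: prob_compl)
  qed
  have "expectation (\<lambda>\<omega>. real (card (\<phi> \<omega> ` s)))
      = expectation (\<lambda>\<omega>. \<Sum>w\<in>V k. of_bool (w \<in> \<phi> \<omega> ` s))"
  proof (rule Bochner_Integration.integral_cong)
    fix \<omega> assume "\<omega> \<in> space M"
    then have "\<phi> \<omega> ` s \<subseteq> V k" using s parent_level by blast
    then have "V k \<inter> {w. w \<in> \<phi> \<omega> ` s} = \<phi> \<omega> ` s" by blast
    then show "real (card (\<phi> \<omega> ` s)) = (\<Sum>w\<in>V k. of_bool (w \<in> \<phi> \<omega> ` s))"
      using finite_level[of k] by (simp add: sum_of_bool_eq)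
  qed simp
  also have "\<dots> = (\<Sum>w\<in>V k. expectation (\<lambda>\<omega>. of_bool (w \<in> \<phi> \<omega> ` s)))"
    by (intro Bochner_Integration.integral_sum determined_integrable[OF fin sb] determined_comp[OF det])
  also have "\<dots> = card (V k) * (1 - (1 - 1 / card (V k)) ^ card s)"
    using hit by simp
  finally show ?thesis .
qed

text \<open>Jensen's inequality for \<open>1 / N\<close>, where \<open>N\<close> is the number of parents, combined with the occupancy
  bound. The increment \<open>1 / (4 M)\<close> does not depend on the size of \<open>s\<close>; this is why the reciprocal of
  the number of ancestors is the right quantity to follow.\<close>
lemma expected_inverse_number_of_parents:
  assumes s: "s \<subseteq> V (Suc k)" and "s \<noteq> {}"
  shows "1 / card s + of_bool (2 \<le> card s) / (4 * real (card (V k)))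
    \<le> expectation (\<lambda>\<omega>. 1 / real (card (\<phi> \<omega> ` s)))"
proof (cases "2 \<le> card s")
  case False
  have "finite s" using s finite_level by (rule finite_subset)
  then have "card s > 0" using \<open>s \<noteq> {}\<close> by (simp add: card_gt_0_iff)
  with False have "card s = 1" by simp
  then obtain v where "s = {v}" by (auto simp: card_1_singleton_iff)
  then show ?thesis using prob_space by simp
next
  case True
  have fin: "finite s" using s finite_level by (rule finite_subset)
  have sb: "s \<subseteq> children" using s by blast
  have det: "determined s (\<lambda>\<omega>. \<phi> \<omega> ` s)" by (intro determinedI) auto
  define e where "e = expectation (\<lambda>\<omega>. real (card (\<phi> \<omega> ` s)))"
  define K where "K = real (card (V k))"
  define a where "a = card s"
  have K: "K \<ge> 1" using card_level_pos[of k] by (simp add: K_def)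
  have a: "a \<ge> 2" using True by (simp add: a_def)
  have e_eq: "e = K * (1 - (1 - 1 / K) ^ a)"
    unfolding e_def K_def a_def by (rule expected_number_of_parents[OF s])
  have "(1 - 1 / K) ^ a < 1" using K a by (simp add: power_less_one_iff)
  then have e_pos: "e > 0" using K by (simp add: e_eq)
  have "e \<le> K * (a * (1 / K) / (1 + a * (1 / K) / 4))"
    unfolding e_eq using K a by (intro mult_left_mono occupancy_bound) auto
  also have "\<dots> = a / (1 + a / (4 * K))" using K by (simp add: field_simps)
  finally have e_le: "e \<le> a / (1 + a / (4 * K))" .
  have "1 / a + 1 / (4 * K) = 1 / (a / (1 + a / (4 * K)))" using K a by (simp add: field_simps)
  also have "\<dots> \<le> 1 / e" 
    using le_imp_inverse_le[OF e_le e_pos] by (simp only: inverse_eq_divide)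
  \<comment> \<open>Jensen's inequality by means of the tangent \<open>2 / e - N / e\<^sup>2\<close> to \<open>1 / N\<close> at \<open>N = e\<close>.\<close>
  also have "\<dots> = 2 / e - e / e\<^sup>2" using e_pos by (simp add: field_simps power2_eq_square)
  also have "\<dots> = expectation (\<lambda>\<omega>. 2 / e - card (\<phi> \<omega> ` s) / e\<^sup>2)"
  proof -
    have "integrable M (\<lambda>\<omega>. real (card (\<phi> \<omega> ` s)))"
      by (rule determined_integrable[OF fin sb determined_comp[OF det]])
    then show ?thesis by (simp add: e_def[symmetric] prob_space)
  qed
  also have "\<dots> \<le> expectation (\<lambda>\<omega>. 1 / real (card (\<phi> \<omega> ` s)))"
  proof (rule integral_mono)
    show "integrable M (\<lambda>\<omega>. 2 / e - card (\<phi> \<omega> ` s) / e\<^sup>2)"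
      by (rule determined_integrable[OF fin sb determined_comp[OF det]])
    show "integrable M (\<lambda>\<omega>. 1 / real (card (\<phi> \<omega> ` s)))"
      by (rule determined_integrable[OF fin sb determined_comp[OF det]])
    fix \<omega>
    define N where "N = real (card (\<phi> \<omega> ` s))"
    have "N > 0" using fin \<open>s \<noteq> {}\<close> by (simp add: N_def card_gt_0_iff)
    have "1 / N - (2 / e - N / e\<^sup>2) = (N - e)\<^sup>2 / (N * e\<^sup>2)"
      using \<open>N > 0\<close> e_pos by (simp add: field_simps power2_eq_square)
    also have "\<dots> \<ge> 0" using \<open>N > 0\<close> by simp
    finally show "2 / e - card (\<phi> \<omega> ` s) / e\<^sup>2 \<le> 1 / real (card (\<phi> \<omega> ` s))" by (simp add: N_def)
  qed
  finally show ?thesis using True by (simp add: a_def K_def)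
qed

text \<open>For each of the \<open>M\<close> vertices of level \<open>k\<close>, both choose it with probability \<open>1 / M\<^sup>2\<close>.\<close>
lemma prob_siblings:
  assumes "a \<in> V (Suc k)" "b \<in> V (Suc k)" "a \<noteq> b"
  shows "expectation (\<lambda>\<omega>. of_bool (\<phi> \<omega> a = \<phi> \<omega> b)) = 1 / card (V k)"
proof -
  have ab: "finite {a, b}" "{a, b} \<subseteq> children" using assms by blast+
  have both: "expectation (\<lambda>\<omega>. of_bool (\<phi> \<omega> a = w \<and> \<phi> \<omega> b = w)) = (1 / card (V k))\<^sup>2"
    if "w \<in> V k" for w
  proof -
    have "determined {a, b} (\<lambda>\<omega>. \<phi> \<omega> a = w \<and> \<phi> \<omega> b = w)" by (intro determinedI) auto
    then have "expectation (\<lambda>\<omega>. of_bool (\<phi> \<omega> a = w \<and> \<phi> \<omega> b = w))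
        = prob {\<omega> \<in> space M. \<phi> \<omega> a = w \<and> \<phi> \<omega> b = w}"
      by (rule determined_event(2)[OF ab])
    also have "\<dots> = (1 / card (V k))\<^sup>2"
      using prob_all_parents[OF ab, of "\<lambda>_. {w}"] uniform_parent[of _ k w] assms that
      by (simp add: power2_eq_square)
    finally show ?thesis .
  qed
  have "expectation (\<lambda>\<omega>. of_bool (\<phi> \<omega> a = \<phi> \<omega> b))
      = expectation (\<lambda>\<omega>. \<Sum>w\<in>V k. of_bool (\<phi> \<omega> a = w \<and> \<phi> \<omega> b = w) :: real)"
  proof (rule Bochner_Integration.integral_cong)
    fix \<omega> assume "\<omega> \<in> space M"
    then have "\<phi> \<omega> a \<in> V k" using assms parent_level by blast
    then have "V k \<inter> {w. \<phi> \<omega> a = w \<and> \<phi> \<omega> b = w} = (if \<phi> \<omega> a = \<phi> \<omega> b then {\<phi> \<omega> a} else {})"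
      by auto
    then show "of_bool (\<phi> \<omega> a = \<phi> \<omega> b) = (\<Sum>w\<in>V k. of_bool (\<phi> \<omega> a = w \<and> \<phi> \<omega> b = w) :: real)"
      using finite_level[of k] by (simp add: sum_of_bool_eq)
  qed simp
  also have "\<dots> = (\<Sum>w\<in>V k. expectation (\<lambda>\<omega>. of_bool (\<phi> \<omega> a = w \<and> \<phi> \<omega> b = w)))"
    by (intro Bochner_Integration.integral_sum determined_integrable[OF ab] determinedI) auto
  also have "\<dots> = 1 / card (V k)" using both by (simp add: power2_eq_square)
  finally show ?thesis .
qed

section \<open>Coalescence when the sum diverges\<close>

text \<open>The ancestors on level \<open>k + 1\<close> depend on the parents above that level only, so their own parents
  may be resampled, and the one-step estimate applies to each possible set of ancestors.\<close>
lemma expected_inverse_ancestors_step: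
  assumes "k < m"
  shows "expectation (\<lambda>\<omega>. 1 / card ((\<phi> \<omega> ^^ (m - Suc k)) ` V m)
        + of_bool (2 \<le> card ((\<phi> \<omega> ^^ (m - Suc k)) ` V m)) / (4 * real (card (V k))))
      \<le> expectation (\<lambda>\<omega>. 1 / card ((\<phi> \<omega> ^^ (m - k)) ` V m))"
proof -
  define S where "S \<omega> = (\<phi> \<omega> ^^ (m - Suc k)) ` V m" for \<omega>
  define J where "J = levels_between (Suc k) m"
  define H where "H \<omega> \<omega>' = 1 / real (card (\<phi> \<omega>' ` S \<omega>))" for \<omega> \<omega>'
  note Jb = levels_between_children[of "Suc k" m, folded J_def]
  have detS: "determined J S"
    unfolding S_def J_def using assms by (intro determined_ancestors) simp
  have S_level: "S \<omega> \<subseteq> V (Suc k)" if "\<omega> \<in> space M" for \<omega>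
    unfolding S_def using assms that by (intro ancestors_level) auto
  have S_ne: "S \<omega> \<noteq> {}" for \<omega> using level_nonempty by (simp add: S_def)
  have H1: "determined J (\<lambda>\<omega>. H \<omega> \<omega>')" for \<omega>'
    unfolding H_def by (rule determined_comp[OF detS])
  have H2: "determined (V (Suc k)) (H \<omega>)" if "\<omega> \<in> space M" for \<omega>
  proof (rule determinedI)
    fix \<omega>\<^sub>1 \<omega>\<^sub>2 assume "\<And>v. v \<in> V (Suc k) \<Longrightarrow> \<phi> \<omega>\<^sub>1 v = \<phi> \<omega>\<^sub>2 v"
    then have "\<phi> \<omega>\<^sub>1 ` S \<omega> = \<phi> \<omega>\<^sub>2 ` S \<omega>" using S_level[OF that] by (intro image_cong) auto
    then show "H \<omega> \<omega>\<^sub>1 = H \<omega> \<omega>\<^sub>2" by (simp add: H_def)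
  qed
  have "expectation (\<lambda>\<omega>. 1 / card (S \<omega>) + of_bool (2 \<le> card (S \<omega>)) / (4 * real (card (V k))))
      \<le> expectation (\<lambda>\<omega>. expectation (H \<omega>))"
  proof (rule integral_mono)
    show "integrable M (\<lambda>\<omega>. 1 / card (S \<omega>) + of_bool (2 \<le> card (S \<omega>)) / (4 * real (card (V k))))"
      by (rule determined_integrable[OF Jb determined_comp[OF detS]])
    have "determined J (\<lambda>\<omega>. expectation (H \<omega>))"
      unfolding H_def by (rule determined_comp[OF detS])
    then show "integrable M (\<lambda>\<omega>. expectation (H \<omega>))" by (rule determined_integrable[OF Jb])
    show "1 / card (S \<omega>) + of_bool (2 \<le> card (S \<omega>)) / (4 * real (card (V k))) \<le> expectation (H \<omega>)"
      if "\<omega> \<in> space M" for \<omega>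
      unfolding H_def using expected_inverse_number_of_parents[OF S_level[OF that] S_ne] by simp
  qed
  also have "\<dots> = expectation (\<lambda>\<omega>. H \<omega> \<omega>)"
    using level_disjoint_above[of k m]
    by (intro expectation_resample[OF Jb level_children[of k] _ H1 H2, symmetric]) (simp_all add: J_def)
  also have "\<dots> = expectation (\<lambda>\<omega>. 1 / card ((\<phi> \<omega> ^^ (m - k)) ` V m))"
    unfolding H_def S_def using ancestor_step[OF assms] by (simp add: image_image)
  finally show ?thesis by (simp only: S_def)
qed

text \<open>The expected reciprocal of the number of ancestors gains \<open>1 / (4 M\<^sub>k)\<close> on level \<open>k\<close> as long as there
  are at least two ancestors on level \<open>k + 1\<close>. On the event that two are left on level \<open>n\<close> this holds
  for every \<open>k\<close> in between, since the number of ancestors does not grow downwards. The total gain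
  cannot exceed 1.\<close>
lemma prob_not_coalesced:
  assumes "n \<le> m"
  shows "prob {\<omega> \<in> space M. 2 \<le> card ((\<phi> \<omega> ^^ (m - n)) ` V m)} * (\<Sum>k\<in>{n..<m}. 1 / card (V k)) \<le> 4"
    (is "?q * _ \<le> _")
proof -
  define A where "A k \<omega> = card ((\<phi> \<omega> ^^ (m - k)) ` V m)" for k \<omega>
  have det: "determined (levels_between k m) (A k)" if "k \<le> m" for k
    unfolding A_def by (rule determined_comp[OF determined_ancestors[OF that]])
  have int: "integrable M (\<lambda>\<omega>. G (A k \<omega>) :: real)" if "k \<le> m" for G k
    by (rule determined_integrable[OF levels_between_children determined_comp[OF det[OF that]]])
  have A_pos: "0 < A k \<omega>" for k \<omega>
    using finite_level level_nonempty by (simp add: A_def card_gt_0_iff)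
  have A_mono: "A n \<omega> \<le> A k \<omega>" if "n \<le> k" "k \<le> m" for k \<omega>
  proof -
    have "m - n = (k - n) + (m - k)" using that by simp
    then have "(\<phi> \<omega> ^^ (m - n)) ` V m = (\<phi> \<omega> ^^ (k - n)) ` (\<phi> \<omega> ^^ (m - k)) ` V m"
      by (simp only: funpow_add image_comp)
    then show ?thesis unfolding A_def using finite_level[of m] by (simp add: card_image_le)
  qed
  have q: "expectation (\<lambda>\<omega>. of_bool (2 \<le> A n \<omega>)) = ?q"
    using determined_event(2)[OF levels_between_children determined_comp[OF det[OF assms]], of "\<lambda>a. 2 \<le> a"]
    by (simp add: A_def)
  have "expectation (\<lambda>\<omega>. 1 / A k \<omega>) + ?q * (\<Sum>j\<in>{n..<k}. 1 / (4 * real (card (V j))))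
      \<le> expectation (\<lambda>\<omega>. 1 / A n \<omega>)" if "n \<le> k" "k \<le> m" for k
    using that
  proof (induction k rule: dec_induct)
    case (step k)
    have i1: "integrable M (\<lambda>\<omega>. 1 / real (A (Suc k) \<omega>))" by (rule int[OF step.prems])
    have i2: "integrable M (\<lambda>\<omega>. of_bool (2 \<le> A n \<omega>) / (4 * real (card (V k))))" by (rule int[OF assms])
    have "expectation (\<lambda>\<omega>. 1 / A (Suc k) \<omega>) + ?q / (4 * real (card (V k)))
        = expectation (\<lambda>\<omega>. 1 / A (Suc k) \<omega> + of_bool (2 \<le> A n \<omega>) / (4 * real (card (V k))))"
      using Bochner_Integration.integral_add[OF i1 i2] q by simp
    also have "\<dots> \<le> expectation (\<lambda>\<omega>. 1 / A (Suc k) \<omega> + of_bool (2 \<le> A (Suc k) \<omega>) / (4 * real (card (V k))))"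
    proof (rule integral_mono)
      show "integrable M (\<lambda>\<omega>. 1 / A (Suc k) \<omega> + of_bool (2 \<le> A n \<omega>) / (4 * real (card (V k))))"
        by (rule Bochner_Integration.integrable_add[OF i1 i2])
      show "integrable M (\<lambda>\<omega>. 1 / A (Suc k) \<omega> + of_bool (2 \<le> A (Suc k) \<omega>) / (4 * real (card (V k))))"
        by (rule int[OF step.prems])
      show "1 / A (Suc k) \<omega> + of_bool (2 \<le> A n \<omega>) / (4 * real (card (V k)))
          \<le> 1 / A (Suc k) \<omega> + of_bool (2 \<le> A (Suc k) \<omega>) / (4 * real (card (V k)))" for \<omega>
        using A_mono[of "Suc k" \<omega>] step by (intro add_left_mono divide_right_mono) auto
    qed
    also have "\<dots> \<le> expectation (\<lambda>\<omega>. 1 / A k \<omega>)"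
      unfolding A_def using step by (intro expected_inverse_ancestors_step) simp
    finally show ?case using step by (simp add: distrib_left)
  qed simp
  from this[OF assms order_refl]
  have "?q * (\<Sum>j\<in>{n..<m}. 1 / (4 * real (card (V j)))) \<le> expectation (\<lambda>\<omega>. 1 / A n \<omega>) - expectation (\<lambda>\<omega>. 1 / A m \<omega>)"
    by simp
  also have "\<dots> \<le> 1"
  proof -
    have "expectation (\<lambda>\<omega>. 1 / A n \<omega>) \<le> expectation (\<lambda>\<omega>. 1)"
      using int[OF assms, of "\<lambda>a. 1 / real a"] A_pos by (intro integral_mono) (auto simp: Suc_le_eq)
    moreover have "0 \<le> expectation (\<lambda>\<omega>. 1 / A m \<omega>)" by (intro integral_nonneg_AE) auto
    moreover have "expectation (\<lambda>\<omega>. 1) = (1 :: real)" by (simp add: prob_space)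
    ultimately show ?thesis by linarith
  qed
  also have "(\<Sum>j\<in>{n..<m}. 1 / (4 * real (card (V j)))) = (\<Sum>j\<in>{n..<m}. 1 / card (V j)) / 4"
    by (simp add: sum_divide_distrib mult.commute)
  finally show ?thesis by simp
qed

text \<open>If the levels above \<open>n\<close> all had several ancestors on level \<open>n\<close> with positive probability \<open>b\<close>, then
  \<open>4 / b\<close> would bound the partial sums from \<open>n\<close> on.\<close>
lemma AE_card_ancestral_lines_eq_1:
  assumes div: "\<not> summable (\<lambda>n. 1 / real (card (V n)))"
  shows "AE \<omega> in M. card (ancestral_lines V (\<phi> \<omega>)) = 1"
proof -
  have "AE \<omega> in M. \<exists>m\<ge>n. card ((\<phi> \<omega> ^^ (m - n)) ` V m) < 2" for n
  proof -
    define E where "E m = {\<omega> \<in> space M. 2 \<le> card ((\<phi> \<omega> ^^ (m - n)) ` V m)}" for m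
    have ev: "E m \<in> events" if "n \<le> m" for m
      unfolding E_def
      by (rule determined_event(1)[OF levels_between_children determined_comp[OF determined_ancestors[OF that]]])
    define b where "b = prob (\<Inter>m\<in>{n..}. E m)"
    have b_event: "(\<Inter>m\<in>{n..}. E m) \<in> events" using ev by (intro sets.countable_INT') auto
    have b_le: "b * (\<Sum>k\<in>{n..<m}. 1 / card (V k)) \<le> 4" if "n \<le> m" for m
    proof -
      have "b \<le> prob (E m)"
        unfolding b_def using ev[OF that] that by (intro finite_measure_mono) auto
      then have "b * (\<Sum>k\<in>{n..<m}. 1 / card (V k)) \<le> prob (E m) * (\<Sum>k\<in>{n..<m}. 1 / card (V k))"
        by (intro mult_right_mono sum_nonneg) auto
      also have "\<dots> \<le> 4" unfolding E_def by (rule prob_not_coalesced[OF that])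
      finally show ?thesis .
    qed
    have "b = 0"
    proof (rule ccontr)
      assume "b \<noteq> 0"
      then have "b > 0" by (simp add: b_def measure_nonneg order_less_le)
      have "(\<Sum>k<m. 1 / real (card (V k))) \<le> (\<Sum>k<n. 1 / card (V k)) + 4 / b" for m
      proof (cases "n \<le> m")
        case True
        then have "(\<Sum>k<m. 1 / real (card (V k)))
            = (\<Sum>k<n. 1 / card (V k)) + (\<Sum>k\<in>{n..<m}. 1 / card (V k))"
          unfolding lessThan_atLeast0 by (intro sum.atLeastLessThan_concat[symmetric]) auto
        then show ?thesis using b_le[OF True] \<open>b > 0\<close> by (simp add: le_divide_eq mult.commute)
      next
        case False
        then have "(\<Sum>k<m. 1 / real (card (V k))) \<le> (\<Sum>k<n. 1 / card (V k))"
          by (intro sum_mono2) auto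
        moreover have "0 \<le> 4 / b" using \<open>b > 0\<close> by simp
        ultimately show ?thesis by linarith
      qed
      then have "summable (\<lambda>n. 1 / real (card (V n)))"
        by (intro summableI_nonneg_bounded) auto
      with div show False ..
    qed
    then have "AE \<omega> in M. \<omega> \<notin> (\<Inter>m\<in>{n..}. E m)"
      using b_event by (intro AE_not_in) (simp add: b_def null_sets_def emeasure_eq_measure)
    then show ?thesis
      by (rule AE_mp) (auto simp: E_def not_le)
  qed
  then have "AE \<omega> in M. \<forall>n. \<exists>m\<ge>n. card ((\<phi> \<omega> ^^ (m - n)) ` V m) < 2"
    by (simp add: AE_all_countable)
  then show ?thesis
  proof (rule AE_mp, intro AE_I2 impI)
    fix \<omega> assume "\<omega> \<in> space M" "\<forall>n. \<exists>m\<ge>n. card ((\<phi> \<omega> ^^ (m - n)) ` V m) < 2"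
    then show "card (ancestral_lines V (\<phi> \<omega>)) = 1"
      by (intro card_ancestral_lines_eq_1 finite_level level_nonempty parent_maps) auto
  qed
qed

section \<open>Spreading when the sum converges\<close>

text \<open>A union bound over the level on which the ancestors of \<open>x\<close> and \<open>y\<close> first meet: given that they
  differ on level \<open>k + 1\<close>, they meet on level \<open>k\<close> with probability \<open>1 / M\<^sub>k\<close>.\<close>
lemma expected_kin:
  assumes "x \<in> V m" "y \<in> V m" "n \<le> m"
  shows "expectation (\<lambda>\<omega>. of_bool ((\<phi> \<omega> ^^ (m - n)) x = (\<phi> \<omega> ^^ (m - n)) y))
    \<le> of_bool (x = y) + (\<Sum>k\<in>{n..<m}. 1 / card (V k))"
  using \<open>n \<le> m\<close>
proof (induction n rule: inc_induct)
  case base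
  show ?case by (simp add: prob_space)
next
  case (step k)
  define a where "a z \<omega> = (\<phi> \<omega> ^^ (m - Suc k)) z" for z \<omega>
  define P where "P \<omega> = (a x \<omega>, a y \<omega>)" for \<omega>
  define J where "J = levels_between (Suc k) m"
  define H where "H \<omega> \<omega>' = (of_bool (\<phi> \<omega>' (fst (P \<omega>)) = \<phi> \<omega>' (snd (P \<omega>))) :: real)" for \<omega> \<omega>'
  note Jb = levels_between_children[of "Suc k" m, folded J_def]
  have "determined J (a z)" if "z \<in> V m" for z
    unfolding a_def J_def using step that by (intro determined_ancestor) auto
  then have detP: "determined J P"
    unfolding P_def determined_def using assms(1,2) by blast
  have a_level: "a z \<omega> \<in> V (Suc k)" if "\<omega> \<in> space M" "z \<in> V m" for z \<omega>
    using ancestors_level[OF that(1), of "Suc k" m] that(2) step by (auto simp: a_def)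
  have H1: "determined J (\<lambda>\<omega>. H \<omega> \<omega>')" for \<omega>'
    unfolding H_def by (rule determined_comp[OF detP])
  have H2: "determined (V (Suc k)) (H \<omega>)" if "\<omega> \<in> space M" for \<omega>
    using a_level[OF that] assms(1,2) by (intro determinedI) (simp add: H_def P_def)
  have "expectation (\<lambda>\<omega>. of_bool ((\<phi> \<omega> ^^ (m - k)) x = (\<phi> \<omega> ^^ (m - k)) y)) = expectation (\<lambda>\<omega>. H \<omega> \<omega>)"
    unfolding H_def P_def a_def using ancestor_step[OF step.hyps(2)] by simp
  also have "\<dots> = expectation (\<lambda>\<omega>. expectation (H \<omega>))"
    using level_disjoint_above[of k m]
    by (intro expectation_resample[OF Jb level_children[of k] _ H1 H2]) (simp_all add: J_def)
  also have "\<dots> \<le> expectation (\<lambda>\<omega>. of_bool (fst (P \<omega>) = snd (P \<omega>)) + 1 / card (V k))"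
  proof (rule integral_mono)
    have "determined J (\<lambda>\<omega>. expectation (H \<omega>))"
      unfolding H_def by (rule determined_comp[OF detP])
    then show "integrable M (\<lambda>\<omega>. expectation (H \<omega>))" by (rule determined_integrable[OF Jb])
    show "integrable M (\<lambda>\<omega>. of_bool (fst (P \<omega>) = snd (P \<omega>)) + 1 / card (V k))"
      by (rule determined_integrable[OF Jb determined_comp[OF detP]])
    fix \<omega> assume \<omega>: "\<omega> \<in> space M"
    show "expectation (H \<omega>) \<le> of_bool (fst (P \<omega>) = snd (P \<omega>)) + 1 / card (V k)"
    proof (cases "a x \<omega> = a y \<omega>")
      case True
      then have "H \<omega> = (\<lambda>_. 1)" by (intro ext) (simp add: H_def P_def)
      then show ?thesis using True by (simp add: P_def prob_space)
    next
      case False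
      have "H \<omega> = (\<lambda>\<omega>'. of_bool (\<phi> \<omega>' (a x \<omega>) = \<phi> \<omega>' (a y \<omega>)))"
        by (intro ext) (simp add: H_def P_def)
      then show ?thesis
        using prob_siblings[OF a_level[OF \<omega> assms(1)] a_level[OF \<omega> assms(2)] False] by simp
    qed
  qed
  also have "\<dots> = expectation (\<lambda>\<omega>. of_bool (fst (P \<omega>) = snd (P \<omega>))) + 1 / card (V k)"
    using determined_integrable[OF Jb determined_comp[OF detP], of "\<lambda>p. of_bool (fst p = snd p)"]
    by (simp add: prob_space)
  also have "expectation (\<lambda>\<omega>. of_bool (fst (P \<omega>) = snd (P \<omega>)))
      \<le> of_bool (x = y) + (\<Sum>j\<in>{Suc k..<m}. 1 / card (V j))"
    using step.IH by (simp add: P_def a_def)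
  also have "of_bool (x = y) + (\<Sum>j\<in>{Suc k..<m}. 1 / card (V j)) + 1 / card (V k)
      = of_bool (x = y) + (\<Sum>j\<in>{k..<m}. 1 / real (card (V j)))"
    using step.hyps(2) by (simp add: sum.atLeast_Suc_lessThan)
  finally show ?case by simp
qed

lemma kin_fraction_determined:
  assumes "n \<le> m"
  shows "determined (levels_between n m) (\<lambda>\<omega>. kin_fraction V (\<phi> \<omega>) n m)"
proof (rule determinedI)
  fix \<omega> \<omega>' assume "\<omega> \<in> space M" "\<omega>' \<in> space M" "\<And>v. v \<in> levels_between n m \<Longrightarrow> \<phi> \<omega> v = \<phi> \<omega>' v"
  then have "(\<phi> \<omega> ^^ (m - n)) x = (\<phi> \<omega>' ^^ (m - n)) x" if "x \<in> V m" for x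
    by (rule determinedD[OF determined_ancestor[OF that assms]])
  then show "kin_fraction V (\<phi> \<omega>) n m = kin_fraction V (\<phi> \<omega>') n m"
    by (simp add: kin_fraction_def cong: sum.cong)
qed

text \<open>The term \<open>k = m\<close> of the bound accounts for the pairs with \<open>x = y\<close>.\<close>
lemma expected_kin_fraction:
  assumes "n \<le> m"
  shows "expectation (\<lambda>\<omega>. kin_fraction V (\<phi> \<omega>) n m) \<le> (\<Sum>k\<in>{n..m}. 1 / card (V k))"
proof -
  let ?C = "\<lambda>x y \<omega>. of_bool ((\<phi> \<omega> ^^ (m - n)) x = (\<phi> \<omega> ^^ (m - n)) y) :: real"
  define t where "t = (\<Sum>k\<in>{n..<m}. 1 / real (card (V k)))"
  define K where "K = real (card (V m))"
  have K: "K > 0" using card_level_pos by (simp add: K_def)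
  have int: "integrable M (?C x y)" if "x \<in> V m" "y \<in> V m" for x y
  proof (rule determined_integrable[OF levels_between_children], rule determinedI)
    fix \<omega> \<omega>' assume "\<omega> \<in> space M" "\<omega>' \<in> space M" "\<And>v. v \<in> levels_between n m \<Longrightarrow> \<phi> \<omega> v = \<phi> \<omega>' v"
    then have "(\<phi> \<omega> ^^ (m - n)) z = (\<phi> \<omega>' ^^ (m - n)) z" if "z \<in> V m" for z
      by (rule determinedD[OF determined_ancestor[OF that assms]])
    then show "?C x y \<omega> = ?C x y \<omega>'" using that by simp
  qed
  have "expectation (\<lambda>\<omega>. kin_fraction V (\<phi> \<omega>) n m) = (\<Sum>x\<in>V m. \<Sum>y\<in>V m. expectation (?C x y)) / K\<^sup>2"
    unfolding kin_fraction_def K_def using int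
    by (simp add: Bochner_Integration.integral_sum Bochner_Integration.integrable_sum)
  also have "\<dots> \<le> (\<Sum>x\<in>V m. \<Sum>y\<in>V m. of_bool (x = y) + t) / K\<^sup>2"
    unfolding t_def by (intro divide_right_mono sum_mono expected_kin assms) auto
  also have "(\<Sum>x\<in>V m. \<Sum>y\<in>V m. of_bool (x = y) + t) = K + K * K * t"
  proof -
    have "(\<Sum>y\<in>V m. of_bool (x = y) :: real) = 1" if "x \<in> V m" for x
      using that finite_level[of m] by (simp add: of_bool_def)
    then show ?thesis by (simp add: sum.distrib K_def distrib_left)
  qed
  also have "(K + K * K * t) / K\<^sup>2 = t + 1 / K" using K by (simp add: field_simps power2_eq_square)
  also have "\<dots> = (\<Sum>k\<in>{n..m}. 1 / card (V k))"
    using assms by (simp add: t_def K_def atLeastLessThanSuc_atLeastAtMost[symmetric])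
  finally show ?thesis .
qed

text \<open>Choose levels \<open>r j\<close> beyond which the sum is at most \<open>1 / 4 ^ j\<close>. The weighted sum \<open>W m\<close> of the kin
  fractions from level \<open>m\<close> to the levels \<open>r j\<close>, with weights \<open>2 ^ j\<close>, has expectation at most 2 for
  every \<open>m\<close>. By Fatou's lemma its limit inferior is almost surely finite, so that \<open>W m \<le> C\<close> for
  infinitely many \<open>m\<close>, and on these levels all the kin fractions are bounded by \<open>C / 2 ^ j\<close> at once.\<close>
lemma AE_uncountable_ancestral_lines:
  assumes sum: "summable (\<lambda>n. 1 / real (card (V n)))"
  shows "AE \<omega> in M. uncountable (ancestral_lines V (\<phi> \<omega>))"
proof -
  \<comment> \<open>The requirement \<open>r j \<ge> j\<close> leaves only finitely many \<open>j\<close> with \<open>r j \<le> m\<close>.\<close>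
  have "\<exists>N\<ge>j. \<forall>m. (\<Sum>k\<in>{N..m}. 1 / real (card (V k))) \<le> 1 / 4 ^ j" for j :: nat
  proof -
    obtain N where N: "\<And>m n. m \<ge> N \<Longrightarrow> norm (\<Sum>k\<in>{m..<n}. 1 / real (card (V k))) < 1 / 4 ^ j"
      using sum unfolding summable_Cauchy by (metis zero_less_divide_1_iff zero_less_numeral zero_less_power)
    have "(\<Sum>k\<in>{max N j..m}. 1 / real (card (V k))) \<le> 1 / 4 ^ j" for m
      using N[of "max N j" "Suc m"] by (simp add: atLeastLessThanSuc_atLeastAtMost)
    then show ?thesis by (intro exI[of _ "max N j"]) simp
  qed
  then obtain r where r: "\<And>j. r j \<ge> j"
    and tail: "\<And>j m. (\<Sum>k\<in>{r j..m}. 1 / real (card (V k))) \<le> 1 / 4 ^ j" by metis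
  define W where "W m \<omega> = (\<Sum>j | r j \<le> m. 2 ^ j * kin_fraction V (\<phi> \<omega>) (r j) m)" for m \<omega>
  have finj: "finite {j. r j \<le> m}" for m
    by (rule finite_subset[of _ "{..m}"]) (use order_trans[OF r] in auto)
  have kin_nonneg: "0 \<le> kin_fraction V f n m" for f n m
    unfolding kin_fraction_def by (intro divide_nonneg_nonneg sum_nonneg) auto
  then have W_nonneg: "0 \<le> W m \<omega>" for m \<omega> unfolding W_def by (intro sum_nonneg) auto
  have kin_int: "integrable M (\<lambda>\<omega>. kin_fraction V (\<phi> \<omega>) (r j) m)" if "r j \<le> m" for j m
    by (rule determined_integrable[OF levels_between_children kin_fraction_determined[OF that]])
  have W_int: "integrable M (W m)" for m
    unfolding W_def using kin_int by (intro Bochner_Integration.integrable_sum) auto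
  have EW: "expectation (W m) \<le> 2" for m
  proof -
    have "expectation (W m) = (\<Sum>j | r j \<le> m. 2 ^ j * expectation (\<lambda>\<omega>. kin_fraction V (\<phi> \<omega>) (r j) m))"
      unfolding W_def using kin_int by (subst Bochner_Integration.integral_sum) auto
    also have "\<dots> \<le> (\<Sum>j | r j \<le> m. 2 ^ j * (1 / 4 ^ j))"
    proof (intro sum_mono mult_left_mono)
      fix j assume "j \<in> {j. r j \<le> m}"
      then show "expectation (\<lambda>\<omega>. kin_fraction V (\<phi> \<omega>) (r j) m) \<le> 1 / 4 ^ j"
        using order_trans[OF expected_kin_fraction tail] by simp
    qed simp
    also have "\<dots> = 4 * (\<Sum>j | r j \<le> m. 1 / 2 ^ (j + 2))"
      unfolding sum_distrib_left
      by (intro sum.cong) (auto simp: field_simps power_mult_distrib[symmetric])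
    also have "\<dots> \<le> 2" using sum_half_powers_le[OF finj[of m]] by simp
    finally show ?thesis .
  qed
  have "(\<integral>\<^sup>+ \<omega>. liminf (\<lambda>m. ennreal (W m \<omega>)) \<partial>M) \<le> liminf (\<lambda>m. \<integral>\<^sup>+ \<omega>. ennreal (W m \<omega>) \<partial>M)"
    using W_int by (intro nn_integral_liminf) (simp add: borel_measurable_integrable)
  also have "\<dots> \<le> liminf (\<lambda>m. 2)"
  proof (rule Liminf_mono, rule always_eventually, rule allI)
    fix m
    have "(\<integral>\<^sup>+ \<omega>. ennreal (W m \<omega>) \<partial>M) = ennreal (expectation (W m))"
      using W_int W_nonneg by (intro nn_integral_eq_integral) auto
    also have "\<dots> \<le> 2" using EW[of m] by (metis ennreal_leI ennreal_numeral)
    finally show "(\<integral>\<^sup>+ \<omega>. ennreal (W m \<omega>) \<partial>M) \<le> 2" .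
  qed
  also have "\<dots> = 2" by (simp add: Liminf_const)
  finally have "(\<integral>\<^sup>+ \<omega>. liminf (\<lambda>m. ennreal (W m \<omega>)) \<partial>M) \<noteq> \<infinity>"
    by (auto simp: top_unique)
  then have "AE \<omega> in M. liminf (\<lambda>m. ennreal (W m \<omega>)) \<noteq> \<infinity>"
    using W_int by (intro nn_integral_PInf_AE) (auto simp: borel_measurable_integrable)
  then show ?thesis
  proof (rule AE_mp, intro AE_I2 impI)
    fix \<omega> assume \<omega>: "\<omega> \<in> space M" and fin: "liminf (\<lambda>m. ennreal (W m \<omega>)) \<noteq> \<infinity>"
    have "\<exists>C::nat. \<exists>\<^sub>F m in sequentially. W m \<omega> \<le> C"
    proof (rule ccontr)
      assume "\<not> ?thesis"
      then have ev: "\<forall>\<^sub>F m in sequentially. real C < W m \<omega>" for C :: nat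
        by (simp add: not_frequently not_le)
      have "of_nat C \<le> liminf (\<lambda>m. ennreal (W m \<omega>))" for C :: nat
      proof (rule Liminf_bounded)
        show "\<forall>\<^sub>F m in sequentially. of_nat C \<le> ennreal (W m \<omega>)"
          using ev[of C] by eventually_elim (simp add: ennreal_of_nat_eq_real_of_nat ennreal_leI)
      qed
      then have "liminf (\<lambda>m. ennreal (W m \<omega>)) = \<infinity>"
        by (metis ennreal_Ex_less_of_nat infinity_ennreal_def leD top.not_eq_extremum)
      with fin show False ..
    qed
    then obtain C :: nat where C: "\<exists>\<^sub>\<infinity>m. W m \<omega> \<le> C"
      by (auto simp: cofinite_eq_sequentially)
    have "\<exists>\<^sub>\<infinity>m. \<forall>j. r j \<le> m \<longrightarrow> kin_fraction V (\<phi> \<omega>) (r j) m \<le> C / 2 ^ j"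
      using C
    proof (rule INFM_mono, intro allI impI)
      fix m j assume "W m \<omega> \<le> C" "r j \<le> m"
      have "2 ^ j * kin_fraction V (\<phi> \<omega>) (r j) m \<le> W m \<omega>"
        unfolding W_def using \<open>r j \<le> m\<close> finj kin_nonneg
        by (intro member_le_sum[where f = "\<lambda>j. 2 ^ j * kin_fraction V (\<phi> \<omega>) (r j) m"]) auto
      also have "\<dots> \<le> C" by fact
      finally show "kin_fraction V (\<phi> \<omega>) (r j) m \<le> C / 2 ^ j" by (simp add: field_simps)
    qed
    then show "uncountable (ancestral_lines V (\<phi> \<omega>))"
      by (intro uncountable_ancestral_lines finite_level level_nonempty parent_maps[OF \<omega>])
  qed
qed

end

section \<open>Coordinates of a product measure\<close>

text \<open>The criterion by joint distributions asks for random variables on the whole index type, so outside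
  \<open>I\<close> the coordinates are replaced by constants.\<close>
lemma indep_vars_PiM_coordinates:
  assumes M: "\<And>i. prob_space (M i)" and "I \<noteq> {}"
  shows "prob_space.indep_vars (Pi\<^sub>M I M) M (\<lambda>i \<omega>. \<omega> i) I"
proof -
  interpret M: prob_space "M i" for i by (rule M)
  interpret P: prob_space "Pi\<^sub>M I M" by (intro prob_space_PiM M)
  define c where "c i = (SOME x. x \<in> space (M i))" for i
  have c: "c i \<in> space (M i)" for i
    unfolding c_def by (rule someI_ex) (use M.not_empty[of i] in blast)
  define X where "X i \<omega> = (if i \<in> I then \<omega> i else c i)" for i \<omega>
  have rv: "P.random_variable (M i) (X i)" for i
  proof (cases "i \<in> I")
    case True
    then show ?thesis by (simp add: X_def[abs_def] measurable_component_singleton)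
  next
    case False
    then show ?thesis by (simp add: X_def[abs_def] c)
  qed
  have "P.indep_vars M X I"
  proof (subst P.indep_vars_iff_distr_eq_PiM[OF \<open>I \<noteq> {}\<close> rv])
    have "distr (Pi\<^sub>M I M) (Pi\<^sub>M I M) (\<lambda>\<omega>. \<lambda>i\<in>I. X i \<omega>) = distr (Pi\<^sub>M I M) (Pi\<^sub>M I M) (\<lambda>\<omega>. \<omega>)"
      by (intro distr_cong refl) (auto simp: X_def space_PiM PiE_def extensional_def)
    also have "\<dots> = Pi\<^sub>M I M" by (rule distr_id)
    also have "\<dots> = (\<Pi>\<^sub>M i\<in>I. distr (Pi\<^sub>M I M) (M i) (X i))"
    proof (rule PiM_cong[OF refl])
      fix i assume "i \<in> I"
      then show "M i = distr (Pi\<^sub>M I M) (M i) (X i)"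
        using distr_PiM_component[of I M i] M by (simp add: X_def[abs_def])
    qed
    finally show "distr (Pi\<^sub>M I M) (Pi\<^sub>M I M) (\<lambda>\<omega>. \<lambda>i\<in>I. X i \<omega>)
      = (\<Pi>\<^sub>M i\<in>I. distr (Pi\<^sub>M I M) (M i) (X i))" .
  qed
  moreover have "P.indep_vars M X I \<longleftrightarrow> P.indep_vars M (\<lambda>i \<omega>. \<omega> i) I"
    by (rule P.indep_vars_cong) (auto simp: X_def)
  ultimately show ?thesis by blast
qed

section \<open>The greatest element of a random linear order\<close>

definition linear_orders :: "'e set \<Rightarrow> 'e rel set" where
  "linear_orders E = {R. linear_order_on E R}"

definition orders_with_top :: "'e set \<Rightarrow> 'e \<Rightarrow> 'e rel set" where
  "orders_with_top E e = {R \<in> linear_orders E. \<forall>f\<in>E. (f, e) \<in> R}"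

lemma finite_linear_orders: "finite E \<Longrightarrow> finite (linear_orders E)"
  by (rule finite_subset[of _ "Pow (E \<times> E)"])
    (auto simp: linear_orders_def linear_order_on_def partial_order_on_def preorder_on_def)

lemma linear_orders_nonempty: "linear_orders E \<noteq> {}"
proof -
  obtain r where "well_order_on E r" using well_order_on by blast
  then have "r \<in> linear_orders E" by (simp add: linear_orders_def well_order_on_def)
  then show ?thesis by blast
qed

lemma linear_order_ex1_top:
  assumes "finite E" "E \<noteq> {}" "R \<in> linear_orders E"
  shows "\<exists>!e. e \<in> E \<and> (\<forall>f\<in>E. (f, e) \<in> R)"
proof -
  have R: "refl_on E R" "trans R" "antisym R" "total_on E R"
    using assms(3) by (auto simp: linear_orders_def order_on_defs)
  have "\<exists>e\<in>F. \<forall>f\<in>F. (f, e) \<in> R" if "finite F" "F \<noteq> {}" "F \<subseteq> E" for F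
    using that
  proof (induction F rule: finite_ne_induct)
    case (singleton x)
    then show ?case using R(1) by (auto simp: refl_on_def)
  next
    case (insert x F)
    then obtain e where e: "e \<in> F" "\<forall>f\<in>F. (f, e) \<in> R" by auto
    have "x \<in> E" "e \<in> E" using insert e by auto
    then have xx: "(x, x) \<in> R" and "(x, e) \<in> R \<or> (e, x) \<in> R"
      using R(1,4) unfolding refl_on_def total_on_def by metis+
    from this(2) show ?case
    proof
      assume "(x, e) \<in> R"
      then show ?thesis using e by blast
    next
      assume "(e, x) \<in> R"
      then have "\<forall>f\<in>insert x F. (f, x) \<in> R" using e xx transD[OF R(2), of _ e x] by blast
      then show ?thesis by blast
    qed
  qed
  from this[of E] assms obtain e where "e \<in> E" "\<forall>f\<in>E. (f, e) \<in> R" by blast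
  then show ?thesis using R(3) by (auto intro!: ex1I[of _ e] dest: antisymD)
qed

text \<open>Exchanging \<open>e\<close> and \<open>e'\<close> turns an order with greatest element \<open>e\<close> into one with greatest element
  \<open>e'\<close>.\<close>
lemma card_orders_with_top_le:
  assumes "finite E" "e \<in> E" "e' \<in> E"
  shows "card (orders_with_top E e) \<le> card (orders_with_top E e')"
proof (rule card_inj_on_le)
  define \<tau> where "\<tau> = Transposition.transpose e e'"
  define h where "h R = {(x, y). (\<tau> x, \<tau> y) \<in> R}" for R
  have inv: "\<tau> (\<tau> x) = x" for x by (simp add: \<tau>_def)
  have E: "\<tau> x \<in> E \<longleftrightarrow> x \<in> E" for x
    using assms by (auto simp: \<tau>_def Transposition.transpose_def)
  have inj: "\<tau> x = \<tau> y \<longleftrightarrow> x = y" for x y by (metis inv)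
  show "inj_on h (orders_with_top E e)"
  proof (rule inj_onI)
    fix R S assume "h R = h S"
    then have "h (h R) = h (h S)" by simp
    then show "R = S" by (simp add: h_def inv)
  qed
  have lin: "h R \<in> linear_orders E" if "R \<in> linear_orders E" for R
  proof -
    have R: "R \<subseteq> E \<times> E" "refl_on E R" "trans R" "antisym R" "total_on E R"
      using that by (auto simp: linear_orders_def order_on_defs)
    have "h R \<subseteq> E \<times> E" using R(1) E by (auto simp: h_def)
    moreover have "refl_on E (h R)" using R(2) E by (simp add: refl_on_def h_def)
    moreover have "trans (h R)"
      unfolding h_def using transD[OF R(3)] by (intro transI) blast
    moreover have "antisym (h R)"
      unfolding h_def using antisymD[OF R(4)] inj by (intro antisymI) blast
    moreover have "total_on E (h R)" using R(5) E inj by (simp add: total_on_def h_def)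
    ultimately show ?thesis by (simp add: linear_orders_def order_on_defs)
  qed
  have "\<tau> e' = e" by (simp add: \<tau>_def)
  then show "h ` orders_with_top E e \<subseteq> orders_with_top E e'"
    using lin E by (auto simp: orders_with_top_def h_def)
  show "finite (orders_with_top E e')"
    using finite_linear_orders[OF assms(1)] by (simp add: orders_with_top_def)
qed

lemma card_orders_with_top:
  assumes "finite E" "e \<in> E"
  shows "card E * card (orders_with_top E e) = card (linear_orders E)"
proof -
  have fin: "finite (orders_with_top E f)" for f
    using finite_linear_orders[OF assms(1)] by (simp add: orders_with_top_def)
  have "linear_orders E = (\<Union>f\<in>E. orders_with_top E f)"
    using linear_order_ex1_top[OF assms(1)] assms(2) unfolding orders_with_top_def by blast
  then have "card (linear_orders E) = card (\<Union>f\<in>E. orders_with_top E f)" by simp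
  also have "\<dots> = (\<Sum>f\<in>E. card (orders_with_top E f))"
  proof (intro card_UN_disjoint assms(1) ballI fin impI)
    fix f g assume "f \<in> E" "g \<in> E" "f \<noteq> g"
    then show "orders_with_top E f \<inter> orders_with_top E g = {}"
      using linear_order_ex1_top[OF assms(1)] unfolding orders_with_top_def by blast
  qed
  also have "\<dots> = (\<Sum>f\<in>E. card (orders_with_top E e))"
    using card_orders_with_top_le[OF assms(1)] assms(2) by (intro sum.cong refl antisym) blast+
  finally show ?thesis by simp
qed

section \<open>From diagrams to genealogies\<close>

lemma vertex_orders_eq: "vertex_orders B v = linear_orders (in_edges B v)"
  by (simp add: vertex_orders_def linear_orders_def)

definition top_edge :: "('v, 'e) diagram \<Rightarrow> 'v \<Rightarrow> 'e rel \<Rightarrow> 'e" where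
  "top_edge B v R = (THE e. e \<in> in_edges B v \<and> (\<forall>f\<in>in_edges B v. (f, e) \<in> R))"

definition parent :: "('v, 'e) diagram \<Rightarrow> ('v \<Rightarrow> 'e rel) \<Rightarrow> 'v \<Rightarrow> 'v" where
  "parent B \<omega> v = src B (top_edge B v (\<omega> v))"

locale unit_diagram = bratteli_diagram B for B :: "('v, 'e) diagram" +
  assumes verts_nonempty: "\<And>n. verts B n \<noteq> {}"
    and unit_incidence:
      "\<And>n v w. v \<in> verts B (Suc n) \<Longrightarrow> w \<in> verts B n \<Longrightarrow> incidence B n v w = 1"
begin

lemma vert_level: "v \<in> verts B i \<Longrightarrow> v \<in> verts B j \<Longrightarrow> i = j"
  using disjoint_verts unfolding disjoint_family_on_def by blast

lemma nonroot_verts_eq: "nonroot_verts B = (\<Union>k. verts B (Suc k))"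
proof (rule set_eqI)
  fix v
  have "(\<exists>i. v \<in> verts B i) \<and> v \<notin> verts B 0 \<longleftrightarrow> (\<exists>k. v \<in> verts B (Suc k))"
    by (metis Zero_not_Suc not0_implies_Suc vert_level)
  then show "v \<in> nonroot_verts B \<longleftrightarrow> v \<in> (\<Union>k. verts B (Suc k))" by (simp add: nonroot_verts_def)
qed

lemma in_edges_eq:
  assumes "v \<in> verts B (Suc n)"
  shows "in_edges B v = {e \<in> edges B (Suc n). rng B e = v}"
proof -
  have "i = Suc n" if "1 \<le> i" "e \<in> edges B i" "rng B e = v" for i e
    using rng_edges[OF that(1)] that assms vert_level by blast
  then show ?thesis by (auto simp: in_edges_def all_edges_def)
qed

text \<open>This holds for every element of the vertex type, so that every factor of the product measure is a
  probability measure, also at indices that are not vertices.\<close>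
lemma finite_in_edges: "finite (in_edges B v)"
proof (cases "in_edges B v = {}")
  case False
  then obtain i e where i: "1 \<le> i" "e \<in> edges B i" "rng B e = v"
    by (auto simp: in_edges_def all_edges_def)
  then obtain n where n: "i = Suc n" by (cases i) auto
  have "v \<in> verts B (Suc n)" using rng_edges[OF i(1)] i n by blast
  from in_edges_eq[OF this] show ?thesis using finite_edges[of "Suc n"] by simp
qed simp

lemma src_in_edges:
  assumes v: "v \<in> verts B (Suc n)"
  shows "bij_betw (src B) (in_edges B v) (verts B n)"
proof -
  have src: "src B e \<in> verts B n" if "e \<in> in_edges B v" for e
    using src_edges[of "Suc n"] that unfolding in_edges_eq[OF v] by auto
  have ex1: "\<exists>e. {e \<in> in_edges B v. src B e = w} = {e}" if "w \<in> verts B n" for w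
  proof -
    have "{e \<in> in_edges B v. src B e = w} = {e \<in> edges B (n + 1). rng B e = v \<and> src B e = w}"
      unfolding in_edges_eq[OF v] by auto
    then show ?thesis using unit_incidence[OF v that] by (simp add: incidence_def card_1_singleton_iff)
  qed
  show ?thesis
    unfolding bij_betw_def
  proof
    show "inj_on (src B) (in_edges B v)"
    proof (rule inj_onI)
      fix e f assume ef: "e \<in> in_edges B v" "f \<in> in_edges B v" "src B e = src B f"
      obtain g where "{d \<in> in_edges B v. src B d = src B e} = {g}" using ex1[OF src[OF ef(1)]] by blast
      then have "e \<in> {g}" "f \<in> {g}" using ef by auto
      then show "e = f" by simp
    qed
    show "src B ` in_edges B v = verts B n"
    proof (intro equalityI subsetI)
      fix w assume "w \<in> verts B n"
      from ex1[OF this] obtain e where "e \<in> {e \<in> in_edges B v. src B e = w}" by blast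
      then show "w \<in> src B ` in_edges B v" by auto
    qed (use src in blast)
  qed
qed

lemma in_edges_nonempty: "v \<in> verts B (Suc n) \<Longrightarrow> in_edges B v \<noteq> {}"
  using src_in_edges[of v n] verts_nonempty[of n] by (auto simp: bij_betw_def)

lemma top_edge_props:
  assumes "v \<in> verts B (Suc n)" "R \<in> vertex_orders B v"
  shows "top_edge B v R \<in> in_edges B v" "f \<in> in_edges B v \<Longrightarrow> (f, top_edge B v R) \<in> R"
proof -
  have "R \<in> linear_orders (in_edges B v)" using assms(2) by (simp add: vertex_orders_eq)
  from theI'[OF linear_order_ex1_top[OF finite_in_edges in_edges_nonempty[OF assms(1)] this]]
  show "top_edge B v R \<in> in_edges B v" "f \<in> in_edges B v \<Longrightarrow> (f, top_edge B v R) \<in> R"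
    unfolding top_edge_def by blast+
qed

lemma top_edge_unique:
  assumes "v \<in> verts B (Suc n)" "R \<in> vertex_orders B v" "e \<in> in_edges B v"
    "\<And>f. f \<in> in_edges B v \<Longrightarrow> (f, e) \<in> R"
  shows "top_edge B v R = e"
  unfolding top_edge_def
  by (rule the1_equality[OF linear_order_ex1_top[OF finite_in_edges in_edges_nonempty[OF assms(1)]]])
    (use assms in \<open>auto simp: vertex_orders_eq\<close>)

abbreviation raw_order_measure :: "('v \<Rightarrow> 'e rel) measure" where
  "raw_order_measure \<equiv> Pi\<^sub>M (nonroot_verts B) (\<lambda>v. uniform_count_measure (vertex_orders B v))"

lemma vertex_orders_finite: "finite (vertex_orders B v)" "vertex_orders B v \<noteq> {}"
  unfolding vertex_orders_eq using finite_linear_orders[OF finite_in_edges] linear_orders_nonempty by auto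

lemma prob_vertex_orders: "prob_space (uniform_count_measure (vertex_orders B v))"
  by (rule prob_space_uniform_count_measure) (rule vertex_orders_finite)+

lemma space_orders:
  assumes "\<omega> \<in> space raw_order_measure" "v \<in> verts B (Suc n)"
  shows "\<omega> v \<in> vertex_orders B v"
  using assms by (auto simp: space_PiM space_uniform_count_measure nonroot_verts_eq)

lemma random_genealogy_parent: "random_genealogy raw_order_measure (verts B) (parent B)"
proof -
  interpret prob_space raw_order_measure by (intro prob_space_PiM prob_vertex_orders)
  show ?thesis
  proof
    show "finite (verts B k)" for k by (rule finite_verts)
    show "verts B k \<noteq> {}" for k by (rule verts_nonempty)
    show "disjoint_family (verts B)" by (rule disjoint_verts)
  next
    fix \<omega> k v assume "\<omega> \<in> space raw_order_measure" and v: "v \<in> verts B (Suc k)"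
    then have "top_edge B v (\<omega> v) \<in> in_edges B v" by (intro top_edge_props space_orders)
    then show "parent B \<omega> v \<in> verts B k"
      using src_in_edges[OF v] by (auto simp: parent_def bij_betw_def)
  next
    have ne: "nonroot_verts B \<noteq> {}" using verts_nonempty by (auto simp: nonroot_verts_eq)
    show "indep_vars (\<lambda>_. count_space UNIV) (\<lambda>v \<omega>. parent B \<omega> v) (\<Union>k. verts B (Suc k))"
      unfolding parent_def nonroot_verts_eq[symmetric]
      by (rule indep_vars_compose2[OF indep_vars_PiM_coordinates[OF prob_vertex_orders ne]])
        (simp add: measurable_def space_uniform_count_measure)
  next
    fix k v w assume v: "v \<in> verts B (Suc k)" and w: "w \<in> verts B k"
    then have vI: "v \<in> nonroot_verts B" by (auto simp: nonroot_verts_eq)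
    define E where "E = in_edges B v"
    have E: "finite E" unfolding E_def by (rule finite_in_edges)
    have card_E: "card E = card (verts B k)"
      unfolding E_def by (rule bij_betw_same_card[OF src_in_edges[OF v]])
    have "w \<in> src B ` E"
      using w bij_betw_imp_surj_on[OF src_in_edges[OF v]] by (simp add: E_def)
    then obtain e where e: "e \<in> E" "src B e = w" by auto
    have top_iff: "parent B \<omega> v = w \<longleftrightarrow> \<omega> v \<in> orders_with_top E e" if "\<omega> \<in> space raw_order_measure" for \<omega>
    proof -
      note ord = space_orders[OF that v]
      show ?thesis
      proof
        assume "parent B \<omega> v = w"
        then have "top_edge B v (\<omega> v) = e"
          using e top_edge_props(1)[OF v ord] inj_onD[OF bij_betw_imp_inj_on[OF src_in_edges[OF v]]]
          unfolding parent_def E_def by simp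
        then show "\<omega> v \<in> orders_with_top E e"
          using top_edge_props(2)[OF v ord] ord by (auto simp: orders_with_top_def vertex_orders_eq E_def)
      next
        assume "\<omega> v \<in> orders_with_top E e"
        then have "top_edge B v (\<omega> v) = e"
          using e by (intro top_edge_unique[OF v ord]) (auto simp: orders_with_top_def E_def)
        then show "parent B \<omega> v = w" using e by (simp add: parent_def)
      qed
    qed
    have "prob {\<omega> \<in> space raw_order_measure. parent B \<omega> v = w}
        = prob {\<omega> \<in> space raw_order_measure. \<omega> v \<in> orders_with_top E e}"
      using top_iff by (intro arg_cong[where f = prob]) auto
    also have "\<dots> = measure (distr raw_order_measure (uniform_count_measure (vertex_orders B v)) (\<lambda>\<omega>. \<omega> v))
        (orders_with_top E e)"
      using vI by (subst measure_distr)
        (auto simp: measurable_component_singleton vimage_def Int_def conj_commute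
          sets_uniform_count_measure orders_with_top_def vertex_orders_eq E_def)
    also have "\<dots> = measure (uniform_count_measure (vertex_orders B v)) (orders_with_top E e)"
      by (subst distr_PiM_component[OF prob_vertex_orders vI]) simp
    also have "\<dots> = card (orders_with_top E e) / card (linear_orders E)"
      using vertex_orders_finite[of v] by (subst measure_uniform_count_measure)
        (auto simp: orders_with_top_def vertex_orders_eq E_def)
    also have "\<dots> = 1 / card (verts B k)"
    proof -
      have "card (linear_orders E) \<noteq> 0"
        using finite_linear_orders[OF E] linear_orders_nonempty[of E] by simp
      moreover have "card (linear_orders E) = card (verts B k) * card (orders_with_top E e)"
        using card_orders_with_top[OF E e(1)] by (simp add: card_E)
      ultimately show ?thesis by simp
    qed
    finally show "prob {\<omega> \<in> space raw_order_measure. parent B \<omega> v = w} = 1 / card (verts B k)" .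
  qed
qed

text \<open>A maximal path is recovered from the vertices that it visits: its edge into a vertex is the greatest
  one there, and it starts in the parent of that vertex.\<close>
lemma max_paths_ancestral_lines:
  assumes \<omega>: "\<omega> \<in> space raw_order_measure"
  shows "bij_betw (\<lambda>p n. src B (p n)) (max_paths B \<omega>) (ancestral_lines (verts B) (parent B \<omega>))"
proof -
  define top where "top v = top_edge B v (\<omega> v)" for v
  have path: "rng B (p n) \<in> verts B (Suc n)" "src B (p n) \<in> verts B n"
    "rng B (p n) = src B (p (Suc n))" "p n = top (rng B (p n))"
    if "p \<in> max_paths B \<omega>" for p n
  proof -
    have p: "p n \<in> edges B (Suc n)" "rng B (p n) = src B (p (Suc n))" "max_edge B \<omega> (p n)"
      using that by (auto simp: max_paths_def inf_paths_def)
    show v: "rng B (p n) \<in> verts B (Suc n)" using rng_edges[of "Suc n"] p(1) by auto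
    show "src B (p n) \<in> verts B n" using src_edges[of "Suc n"] p(1) by auto
    show "rng B (p n) = src B (p (Suc n))" by fact
    have "p n \<in> in_edges B (rng B (p n))" unfolding in_edges_eq[OF v] using p(1) by simp
    then show "p n = top (rng B (p n))"
      unfolding top_def using p(3)
      by (intro top_edge_unique[OF v space_orders[OF \<omega> v], symmetric]) (auto simp: max_edge_def)
  qed
  show ?thesis
    unfolding bij_betw_def
  proof
    show "inj_on (\<lambda>p n. src B (p n)) (max_paths B \<omega>)"
    proof (rule inj_onI, rule ext)
      fix p q n
      assume p: "p \<in> max_paths B \<omega>" and q: "q \<in> max_paths B \<omega>"
        and eq: "(\<lambda>n. src B (p n)) = (\<lambda>n. src B (q n))"
      have "rng B (p n) = rng B (q n)"
        using path(3)[OF p, of n] path(3)[OF q, of n] fun_cong[OF eq, of "Suc n"] by simp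
      then show "p n = q n" using path(4)[OF p, of n] path(4)[OF q, of n] by simp
    qed
    show "(\<lambda>p n. src B (p n)) ` max_paths B \<omega> = ancestral_lines (verts B) (parent B \<omega>)"
    proof (intro equalityI subsetI)
      fix x assume "x \<in> (\<lambda>p n. src B (p n)) ` max_paths B \<omega>"
      then obtain p where p: "p \<in> max_paths B \<omega>" and x: "x = (\<lambda>n. src B (p n))" by blast
      have "parent B \<omega> (x (Suc n)) = x n" for n
      proof -
        have "parent B \<omega> (x (Suc n)) = src B (top (rng B (p n)))"
          using path(3)[OF p, of n] by (simp add: x parent_def top_def)
        then show ?thesis using path(4)[OF p, of n] by (simp add: x)
      qed
      then show "x \<in> ancestral_lines (verts B) (parent B \<omega>)" using path(2)[OF p] by (simp add: ancestral_lines_def x)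
    next
      fix x assume "x \<in> ancestral_lines (verts B) (parent B \<omega>)"
      then have x: "x n \<in> verts B n" "parent B \<omega> (x (Suc n)) = x n" for n by (auto simp: ancestral_lines_def)
      define p where "p n = top (x (Suc n))" for n
      have p_in: "p n \<in> in_edges B (x (Suc n))" for n
        unfolding p_def top_def by (rule top_edge_props(1)[OF x(1) space_orders[OF \<omega> x(1)]])
      then have p: "p n \<in> edges B (Suc n)" "rng B (p n) = x (Suc n)" for n
        unfolding in_edges_eq[OF x(1)] by auto
      have src: "src B (p n) = x n" for n
        using x(2)[of n] by (simp add: p_def top_def parent_def)
      have "max_edge B \<omega> (p n)" for n
        unfolding max_edge_def p(2)
        using top_edge_props(2)[OF x(1) space_orders[OF \<omega> x(1)]] by (auto simp: p_def top_def)
      then have "p \<in> max_paths B \<omega>"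
        using p src x(1)[of 0] verts_0 by (auto simp: max_paths_def inf_paths_def)
      moreover have "x = (\<lambda>n. src B (p n))" using src by simp
      ultimately show "x \<in> (\<lambda>p n. src B (p n)) ` max_paths B \<omega>" by blast
    qed
  qed
qed

end

theorem theorem4p2:
  fixes B :: "('v, 'e) diagram" and M :: "nat \<Rightarrow> nat"
  assumes "bratteli_diagram B"
    and "\<And>n. M n = card (verts B n)"
    and "\<And>n. M n \<ge> 1"
    and "\<And>n v w. v \<in> verts B (n + 1) \<Longrightarrow> w \<in> verts B n \<Longrightarrow> incidence B n v w = 1"
  shows "(\<not> summable (\<lambda>n. 1 / real (M n)) \<longrightarrow>
            (AE \<omega> in order_measure B. card (max_paths B \<omega>) = 1)) \<and>
         (summable (\<lambda>n. 1 / real (M n)) \<longrightarrow>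
            (AE \<omega> in order_measure B. uncountable (max_paths B \<omega>)))"
proof -
  interpret bratteli_diagram B by fact
  interpret unit_diagram B
  proof
    show "verts B n \<noteq> {}" for n using assms(2,3)[of n] by auto
    show "incidence B n v w = 1" if "v \<in> verts B (Suc n)" "w \<in> verts B n" for n v w
      using assms(4)[of v n w] that by simp
  qed
  interpret G: random_genealogy raw_order_measure "verts B" "parent B"
    by (rule random_genealogy_parent)
  have one: "AE \<omega> in order_measure B. card (max_paths B \<omega>) = 1"
    if "\<not> summable (\<lambda>n. 1 / real (card (verts B n)))"
    unfolding order_measure_def
    using G.AE_card_ancestral_lines_eq_1[OF that]
  proof (intro AE_completion, elim AE_mp, intro AE_I2 impI)
    fix \<omega> assume "\<omega> \<in> space raw_order_measure" "card (ancestral_lines (verts B) (parent B \<omega>)) = 1"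
    then show "card (max_paths B \<omega>) = 1"
      using bij_betw_same_card[OF max_paths_ancestral_lines] by simp
  qed
  have uncountably_many: "AE \<omega> in order_measure B. uncountable (max_paths B \<omega>)"
    if "summable (\<lambda>n. 1 / real (card (verts B n)))"
    unfolding order_measure_def
    using G.AE_uncountable_ancestral_lines[OF that]
  proof (intro AE_completion, elim AE_mp, intro AE_I2 impI)
    fix \<omega> assume "\<omega> \<in> space raw_order_measure" "uncountable (ancestral_lines (verts B) (parent B \<omega>))"
    then show "uncountable (max_paths B \<omega>)"
      using bij_betw_imp_surj_on[OF max_paths_ancestral_lines] countable_image by metis
  qed
  show ?thesis unfolding assms(2) using one uncountably_many by blast
qed

end
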